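(* On $\mathbb R$, let $T(x)=(1+|x|^2)^{1/2}$, let $a>1$ and $\beta\in\mathbb R$, and consider the probability measure $d\mu_a(x)=C_a\exp(-T(x)^a)\,dx$, where $C_a$ is the normalizing constant, and the weight function $$V=\exp\left(\frac{T^a}{2}\right)T^{-\beta}.$$ Then there exist $C>0$ and $\lambda\in(0,1)$ such that $$\|f\|_2^2\le C\left[\left(\int|f|V\,d\mu_a\right)^2+\left(\int|f|V\,d\mu_a\right)^{2(1-\lambda)}\mathcal E_{\mu_a}(f,f)^{\lambda}\right]$$ for all functions $f$ in the domain of the Dirichlet form $\mathcal E_{\mu_a}$.
   Context: $\|\cdot\|_2$ is the norm of $\mathcal L^2(\mu_a)$. The Dirichlet form is $\mathcal E_{\mu_a}(f,f)=\int f'^2\,d\mu_a$, with domain the set of $f\in\mathcal L^2(\mu_a)$ with (weak) derivative $f'\in\mathcal L^2(\mu_a)$; it is the form associated with the Sturm-Liouville operator $Lf=f''-aT^{a-1}T'f'$. If $\int|f|V\,d\mu_a=+\infty$, the right-hand side is $+\infty$. *)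

theory Defs
  imports "HOL-Analysis.Analysis"
begin

definition L2 :: "'a measure \<Rightarrow> ('a \<Rightarrow> real) set" where
  "L2 M = {f. f \<in> borel_measurable M \<and> integrable M (\<lambda>x. (f x)\<^sup>2)}"

definition L2_norm :: "'a measure \<Rightarrow> ('a \<Rightarrow> real) \<Rightarrow> real" where
  "L2_norm M f = sqrt (\<integral>x. (f x)\<^sup>2 \<partial>M)"

text \<open>Smooth compactly supported functions on the line; the first conjunct says that the
  derivatives of all orders exist.\<close>

definition test_function :: "(real \<Rightarrow> real) \<Rightarrow> bool" where
  "test_function \<phi> \<longleftrightarrow>
     (\<forall>n x. ((deriv ^^ n) \<phi>) differentiable (at x)) \<and>
     (\<exists>K. compact K \<and> (\<forall>x. x \<notin> K \<longrightarrow> \<phi> x = 0))"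

definition has_weak_derivative :: "(real \<Rightarrow> real) \<Rightarrow> (real \<Rightarrow> real) \<Rightarrow> bool" where
  "has_weak_derivative f g \<longleftrightarrow>
     (\<forall>K. compact K \<longrightarrow> set_integrable lborel K f \<and> set_integrable lborel K g) \<and>
     (\<forall>\<phi>. test_function \<phi> \<longrightarrow>
        (\<integral>x. f x * deriv \<phi> x \<partial>lborel) = - (\<integral>x. g x * \<phi> x \<partial>lborel))"

definition T :: "real \<Rightarrow> real" where
  "T x = sqrt (1 + \<bar>x\<bar>\<^sup>2)"

definition norm_const :: "real \<Rightarrow> real" where
  "norm_const a = 1 / (\<integral>x. exp (- (T x powr a)) \<partial>lborel)"

definition mu :: "real \<Rightarrow> real measure" where
  "mu a = density lborel (\<lambda>x. ennreal (norm_const a * exp (- (T x powr a))))"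

definition V :: "real \<Rightarrow> real \<Rightarrow> real \<Rightarrow> real" where
  "V a \<beta> x = exp (T x powr a / 2) * T x powr (- \<beta>)"

definition dirichlet_domain :: "real \<Rightarrow> (real \<Rightarrow> real) set" where
  "dirichlet_domain a = {f \<in> L2 (mu a). \<exists>g \<in> L2 (mu a). has_weak_derivative f g}"

text \<open>Weak derivatives are unique up to null sets, so the integral below does not depend on the
  representative that is chosen.\<close>

definition weak_deriv :: "real \<Rightarrow> (real \<Rightarrow> real) \<Rightarrow> real \<Rightarrow> real" where
  "weak_deriv a f = (SOME g. g \<in> L2 (mu a) \<and> has_weak_derivative f g)"

definition dirichlet_form :: "real \<Rightarrow> (real \<Rightarrow> real) \<Rightarrow> (real \<Rightarrow> real) \<Rightarrow> real" where
  "dirichlet_form a f h = (\<integral>x. weak_deriv a f x * weak_deriv a h x \<partial>mu a)"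

definition weighted_integral :: "real \<Rightarrow> real \<Rightarrow> (real \<Rightarrow> real) \<Rightarrow> ennreal" where
  "weighted_integral a \<beta> f = (\<integral>\<^sup>+x. ennreal (\<bar>f x\<bar> * V a \<beta> x) \<partial>mu a)"

end

theory Submission
  imports Defs "HOL-Computational_Algebra.Polynomial"
begin

text \<open>Write \<open>\<omega> = exp (- T powr a / 2)\<close> for the square root of the unnormalised density. For
  \<open>x \<ge> 0\<close> compare \<open>f x\<close> with the values \<open>f y\<close> for \<open>y\<close> in the window \<open>{x - 2 * \<delta>..x - \<delta>}\<close>:
  as \<open>\<omega>\<close> decreases there, \<open>\<omega> x * \<bar>f x\<bar>\<close> is bounded by the average of \<open>\<omega> x * \<bar>f y\<bar>\<close> plus a constant
  times the integral of \<open>\<omega> * \<bar>f'\<bar>\<close> over an interval of length \<open>2 * \<delta>\<close>. The window stays at distance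
  \<open>\<delta>\<close> from \<open>x\<close>, so \<open>\<omega> x / \<omega> y \<le> exp (- \<delta> * T y powr (a - 1) / 4)\<close> for \<open>y > 2\<close>, and this gain absorbs
  any power of \<open>T y\<close> at the cost of a negative power of \<open>\<delta>\<close>. Squaring, Cauchy-Schwarz and Fubini give
  \<open>\<parallel>f\<parallel>\<^sup>2 \<le> P * (\<delta>\<^sup>2 * E + \<delta> powr (- s) * W\<^sup>2)\<close> for all \<open>0 < \<delta> \<le> 1\<close>, and optimising \<open>\<delta>\<close> gives the theorem
  with exponent \<open>s / (2 + s)\<close>.\<close>

section \<open>Smooth approximations of indicator functions\<close>

text \<open>Polynomials in 1/x times exp (- 1/x), extended by 0, form a family closed under
  differentiation, and \<open>bump 1\<close> is the standard smooth function that is flat at 0.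
  Carrying the polynomial as a parameter makes every derivative explicit.\<close>

definition bump :: "real poly \<Rightarrow> real \<Rightarrow> real" where
  "bump p x = (if x > 0 then poly p (1 / x) * exp (- (1 / x)) else 0)"

lemma poly_times_exp_tendsto_0:
  fixes p :: "real poly"
  shows "((\<lambda>t. poly p t * exp (- t)) \<longlongrightarrow> 0) at_top"
proof -
  have "((\<lambda>t. \<Sum>i\<le>degree p. coeff p i * (t ^ i / exp t)) \<longlongrightarrow> (\<Sum>i\<le>degree p. coeff p i * 0)) at_top"
    by (intro tendsto_intros tendsto_power_div_exp_0)
  then show ?thesis
    by (simp add: poly_altdef sum_distrib_right exp_minus divide_inverse mult.assoc)
qed

text \<open>For x > 0 the product and chain rules turn p(1/x) into (1/x)^2 * (p - p')(1/x), and
  \<open>monom 1 2\<close> is the square of the variable 1/x. The delicate point is x = 0, where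
  both one-sided difference quotients tend to 0.\<close>

lemma DERIV_bump:
  "(bump p has_field_derivative bump (monom 1 2 * (p - pderiv p)) x) (at x)"
proof -
  consider "x > 0" | "x < 0" | "x = 0" by linarith
  then show ?thesis
  proof cases
    case 1
    have "((\<lambda>x. poly p (1 / x) * exp (- (1 / x))) has_field_derivative
            bump (monom 1 2 * (p - pderiv p)) x) (at x)"
      using 1
      by (auto intro!: derivative_eq_intros simp: bump_def poly_monom field_simps power2_eq_square)
    then show ?thesis
      by (rule has_field_derivative_transform_within_open[of _ _ _ "{0<..}"])
         (use 1 in \<open>auto simp: bump_def\<close>)
  next
    case 2
    have "((\<lambda>x. 0) has_field_derivative bump (monom 1 2 * (p - pderiv p)) x) (at x)"
      using 2 by (simp add: bump_def)
    then show ?thesis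
      by (rule has_field_derivative_transform_within_open[of _ _ _ "{..<0}"])
         (use 2 in \<open>auto simp: bump_def\<close>)
  next
    case 3
    \<comment> \<open>Dividing by y multiplies the polynomial in 1/y by its variable, which gives
      \<open>pCons 0 p\<close>; the exponential still wins as 1/y tends to infinity.\<close>
    have "((\<lambda>y. bump p y / y) \<longlongrightarrow> 0) (at_right 0)"
    proof -
      have "((\<lambda>y. poly (pCons 0 p) (inverse y) * exp (- inverse y)) \<longlongrightarrow> 0) (at_right (0::real))"
        by (rule filterlim_compose[OF poly_times_exp_tendsto_0 filterlim_inverse_at_top_right])
      then show ?thesis
        by (rule Lim_transform_eventually)
           (auto simp: eventually_at_filter bump_def field_simps)
    qed
    moreover have "((\<lambda>y. bump p y / y) \<longlongrightarrow> 0) (at_left 0)"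
      by (rule tendsto_eventually) (auto simp: eventually_at_filter bump_def)
    ultimately have "((\<lambda>y. bump p y / y) \<longlongrightarrow> 0) (at 0)"
      using filterlim_split_at by blast
    then show ?thesis
      using 3 by (simp add: has_field_derivative_iff bump_def)
  qed
qed

text \<open>A class of functions closed under differentiation, hence consisting of smooth functions.\<close>

inductive_set smooth_alg :: "(real \<Rightarrow> real) set" where
  smooth_bump: "(\<lambda>t. bump p (c * t + d)) \<in> smooth_alg"
| smooth_const: "(\<lambda>t. c) \<in> smooth_alg"
| smooth_add: "F \<in> smooth_alg \<Longrightarrow> G \<in> smooth_alg \<Longrightarrow> (\<lambda>t. F t + G t) \<in> smooth_alg"
| smooth_mult: "F \<in> smooth_alg \<Longrightarrow> G \<in> smooth_alg \<Longrightarrow> (\<lambda>t. F t * G t) \<in> smooth_alg"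

lemma smooth_alg_DERIV:
  "F \<in> smooth_alg \<Longrightarrow> \<exists>F'\<in>smooth_alg. \<forall>x. (F has_field_derivative F' x) (at x)"
proof (induction rule: smooth_alg.induct)
  case (smooth_bump p c d)
  have "((\<lambda>t. bump p (c * t + d)) has_field_derivative
          bump (monom 1 2 * (p - pderiv p)) (c * x + d) * c) (at x)" for x
    by (rule DERIV_chain2[OF DERIV_bump]) (auto intro!: derivative_eq_intros)
  then show ?case
    using smooth_alg.smooth_mult[OF smooth_alg.smooth_bump[of "monom 1 2 * (p - pderiv p)" c d]
        smooth_alg.smooth_const[of c]]
    by (intro bexI[of _ "\<lambda>x. bump (monom 1 2 * (p - pderiv p)) (c * x + d) * c"]) auto
next
  case (smooth_const c)
  then show ?case
    using smooth_alg.smooth_const[of 0] by (intro bexI[of _ "\<lambda>t. 0"]) auto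
next
  case (smooth_add F G)
  then obtain F' G' where *: "F' \<in> smooth_alg" "G' \<in> smooth_alg"
    "\<And>x. (F has_field_derivative F' x) (at x)" "\<And>x. (G has_field_derivative G' x) (at x)"
    by blast
  then show ?case
    by (intro bexI[of _ "\<lambda>t. F' t + G' t"]) (auto intro: DERIV_add smooth_alg.smooth_add)
next
  case (smooth_mult F G)
  then obtain F' G' where *: "F' \<in> smooth_alg" "G' \<in> smooth_alg"
    "\<And>x. (F has_field_derivative F' x) (at x)" "\<And>x. (G has_field_derivative G' x) (at x)"
    by blast
  then show ?case using smooth_mult.hyps
    by (intro bexI[of _ "\<lambda>t. F' t * G t + G' t * F t"])
       (auto intro: DERIV_mult smooth_alg.smooth_add smooth_alg.smooth_mult)
qed

lemma smooth_alg_isCont: "F \<in> smooth_alg \<Longrightarrow> isCont F x"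
  using smooth_alg_DERIV DERIV_isCont by blast

lemma smooth_alg_measurable:
  assumes "F \<in> smooth_alg" shows "F \<in> borel_measurable borel"
  using assms smooth_alg_isCont
  by (intro borel_measurable_continuous_onI) (auto simp: continuous_on_eq_continuous_at)

lemma smooth_alg_higher_deriv: "F \<in> smooth_alg \<Longrightarrow> (deriv ^^ n) F \<in> smooth_alg"
proof (induction n)
  case (Suc n)
  then obtain F' where "F' \<in> smooth_alg" "\<And>x. ((deriv ^^ n) F has_field_derivative F' x) (at x)"
    using smooth_alg_DERIV by blast
  moreover from this have "deriv ((deriv ^^ n) F) = F'"
    using DERIV_imp_deriv by blast
  ultimately show ?case by simp
qed simp

text \<open>Only the derivative is asked to lie in \<open>smooth_alg\<close>: the functions to be
  used are antiderivatives of members of the class and are not known to be members themselves. The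
  derivative of order m + 1 of \<open>\<phi>\<close> is the one of order m of
  \<open>\<psi>\<close>.\<close>

lemma test_function_primitive:
  assumes D: "\<And>x. (\<phi> has_field_derivative \<psi> x) (at x)" and "\<psi> \<in> smooth_alg"
    and "\<And>x. x \<notin> {a..b} \<Longrightarrow> \<phi> x = 0"
  shows "test_function \<phi>"
  unfolding test_function_def
proof (intro conjI allI)
  fix n x
  have d: "deriv \<phi> = \<psi>" using D DERIV_imp_deriv by blast
  show "((deriv ^^ n) \<phi>) differentiable (at x)"
  proof (cases n)
    case 0
    then show ?thesis using D by (auto simp: real_differentiable_def)
  next
    case (Suc m)
    have "(deriv ^^ m) \<psi> \<in> smooth_alg"
      using assms(2) by (rule smooth_alg_higher_deriv)
    then show ?thesis
      using smooth_alg_DERIV unfolding Suc funpow_Suc_right o_def d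
      by (auto simp: real_differentiable_def)
  qed
next
  show "\<exists>K. compact K \<and> (\<forall>x. x \<notin> K \<longrightarrow> \<phi> x = 0)"
    using assms(3) by (intro exI[of _ "{a..b}"]) auto
qed

text \<open>A product of two bumps, one vanishing left of p and one right of q, is steepened by the
  factor \<open>Suc k\<close> in its arguments. It vanishes at p and q themselves, hence the limit
  is the indicator of the open interval. The primitive \<open>\<Phi> k\<close> rises from 0 to the
  total mass \<open>\<Phi> k q\<close>, which tends to the length of the interval by dominated
  convergence.\<close>

lemma smooth_indicator_approx:
  fixes p q :: real
  assumes "p < q"
  obtains \<eta> \<Phi> :: "nat \<Rightarrow> real \<Rightarrow> real"
  where "\<And>k. \<eta> k \<in> smooth_alg"
    and "\<And>k t. 0 \<le> \<eta> k t" "\<And>k t. \<eta> k t \<le> indicator {p..q} t"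
    and "\<And>t. (\<lambda>k. \<eta> k t) \<longlonglongrightarrow> indicator {p<..<q} t"
    and "\<And>k t. (\<Phi> k has_field_derivative \<eta> k t) (at t)"
    and "\<And>k t. t \<le> p \<Longrightarrow> \<Phi> k t = 0"
    and "\<And>k t. t \<ge> q \<Longrightarrow> \<Phi> k t = \<Phi> k q"
    and "\<And>k s t. s \<le> t \<Longrightarrow> \<Phi> k s \<le> \<Phi> k t"
    and "(\<lambda>k. \<Phi> k q) \<longlonglongrightarrow> q - p"
proof -
  define \<eta> where "\<eta> k t = bump 1 (Suc k * (t - p)) * bump 1 (Suc k * (q - t))" for k :: nat and t
  have sm: "\<eta> k \<in> smooth_alg" for k
  proof -
    have "\<eta> k = (\<lambda>t. bump 1 (real (Suc k) * t + (- real (Suc k) * p)) *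
                  bump 1 ((- real (Suc k)) * t + real (Suc k) * q))"
      by (rule ext) (simp add: \<eta>_def algebra_simps)
    then show ?thesis
      by (metis smooth_mult smooth_bump)
  qed
  have b: "0 \<le> bump 1 x" "bump 1 x \<le> 1" for x
    by (auto simp: bump_def)
  have nn: "0 \<le> \<eta> k t" for k t
    by (simp add: \<eta>_def b)
  have z: "\<eta> k t = 0" if "t \<notin> {p<..<q}" for k t
    using that by (auto simp: \<eta>_def bump_def zero_less_mult_iff)
  have le: "\<eta> k t \<le> indicator {p..q} t" for k t
  proof (cases "t \<in> {p<..<q}")
    case True
    then show ?thesis using mult_mono[OF b(2) b(2) _ b(1)]
      by (auto simp: \<eta>_def indicator_def)
  qed (simp add: z)
  have b1: "(\<lambda>k. bump 1 (Suc k * c)) \<longlonglongrightarrow> 1" if "c > 0" for c :: real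
  proof -
    have "(\<lambda>k. exp (- ((1 / c) * inverse (real (Suc k))))) \<longlonglongrightarrow> exp (- ((1 / c) * 0))"
      by (intro tendsto_intros LIMSEQ_inverse_real_of_nat)
    moreover have "bump 1 (Suc k * c) = exp (- ((1 / c) * inverse (real (Suc k))))" for k
      using that by (simp add: bump_def zero_less_mult_iff divide_inverse mult_ac del: of_nat_Suc)
    ultimately show ?thesis by simp
  qed
  have lim: "(\<lambda>k. \<eta> k t) \<longlonglongrightarrow> indicator {p<..<q} t" for t
  proof (cases "t \<in> {p<..<q}")
    case True
    then have "(\<lambda>k. \<eta> k t) \<longlonglongrightarrow> 1 * 1"
      unfolding \<eta>_def by (intro tendsto_mult b1) auto
    then show ?thesis using True by simp
  qed (simp add: z)
  \<comment> \<open>Continuity yields an antiderivative on the whole line; subtracting its value at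
    p then makes it vanish to the left of the interval.\<close>
  have "\<exists>F. \<forall>x. (F has_field_derivative \<eta> k x) (at x)" for k
    using einterval_antiderivative[of "-\<infinity>" "\<infinity>" "\<eta> k"] smooth_alg_isCont[OF sm]
    by (auto simp: has_real_derivative_iff_has_vector_derivative)
  then obtain F where F: "\<And>k x. (F k has_field_derivative \<eta> k x) (at x)" by metis
  define \<Phi> where "\<Phi> k t = F k t - F k p" for k t
  have D: "(\<Phi> k has_field_derivative \<eta> k t) (at t)" for k t
    unfolding \<Phi>_def using DERIV_diff[OF F DERIV_const] by simp
  have const: "\<Phi> k s = \<Phi> k t" if "s \<le> t" "\<And>x. s < x \<Longrightarrow> x < t \<Longrightarrow> \<eta> k x = 0" for k s t
  proof (cases "s = t")
    case False
    then have "\<Phi> k t = \<Phi> k s"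
      using that D[of k] DERIV_isCont[OF D]
      by (intro DERIV_isconst_end) (auto intro!: continuous_at_imp_continuous_on, metis)
    then show ?thesis by simp
  qed simp
  have left: "\<Phi> k t = 0" if "t \<le> p" for k t
    using const[of t p k] that z by (auto simp: \<Phi>_def)
  have right: "\<Phi> k t = \<Phi> k q" if "t \<ge> q" for k t
    using const[of q t k] that z by auto
  have mono: "\<Phi> k s \<le> \<Phi> k t" if "s \<le> t" for k s t
    using DERIV_nonneg_imp_nondecreasing[OF that] D nn by blast
  have int: "integral\<^sup>L lborel (\<eta> k) = \<Phi> k q" for k
  proof -
    have "(LBINT x. \<eta> k x * indicator {p..q} x) = \<Phi> k q - \<Phi> k p"
      by (rule integral_FTC_Icc_real) (use assms D smooth_alg_isCont[OF sm] in auto)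
    moreover have "\<eta> k x * indicator {p..q} x = \<eta> k x" for x
      using z[of x k] by (cases "x \<in> {p<..<q}") auto
    ultimately show ?thesis using left by simp
  qed
  have "(\<lambda>k. integral\<^sup>L lborel (\<eta> k)) \<longlonglongrightarrow> (LBINT x. indicator {p<..<q} x)"
  proof (rule integral_dominated_convergence[where w = "indicator {p..q}"])
    show "integrable lborel (indicator {p..q} :: real \<Rightarrow> real)"
      by (rule integrable_real_indicator) (use assms in auto)
  qed (use le nn lim smooth_alg_measurable[OF sm] in auto)
  then have "(\<lambda>k. \<Phi> k q) \<longlonglongrightarrow> q - p"
    using assms by (simp add: int)
  with sm nn le lim D left right mono show thesis by (intro that)
qed

section \<open>Weakly differentiable functions\<close>

text \<open>Dominated convergence with majorant |f| on {p..q}; the open and the closed interval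
  differ by a null set.\<close>

lemma lebesgue_integral_indicator_approx:
  fixes f :: "real \<Rightarrow> real" and \<eta> :: "nat \<Rightarrow> real \<Rightarrow> real"
  assumes f: "set_integrable lborel {p..q} f"
    and \<eta>: "\<And>k. \<eta> k \<in> borel_measurable borel" "\<And>k t. 0 \<le> \<eta> k t"
      "\<And>k t. \<eta> k t \<le> indicator {p..q} t" "\<And>t. (\<lambda>k. \<eta> k t) \<longlonglongrightarrow> indicator {p<..<q} t"
  shows "\<And>k. integrable lborel (\<lambda>t. f t * \<eta> k t)"
    and "(\<lambda>k. LBINT t. f t * \<eta> k t) \<longlonglongrightarrow> (LINT t:{p..q}|lborel. f t)"
proof -
  let ?F = "\<lambda>t. indicator {p..q} t * f t"
  have F: "integrable lborel ?F"
    using f by (simp add: set_integrable_def)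
  then have [measurable]: "?F \<in> borel_measurable borel" by auto
  have [measurable]: "\<eta> k \<in> borel_measurable borel" for k by (rule \<eta>)
  \<comment> \<open>The hypothesis gives measurability and integrability only for f cut off to
    {p..q}. Since \<open>\<eta> k\<close> vanishes outside, f can be replaced by this
    truncation.\<close>
  have eq: "f t * \<eta> k t = ?F t * \<eta> k t" for k t
    using \<eta>(2)[of k t] \<eta>(3)[of k t] by (cases "t \<in> {p..q}") auto
  have bd: "norm (?F t * \<eta> k t) \<le> norm (?F t)" for k t
  proof -
    have "\<eta> k t \<le> 1"
      using order_trans[OF \<eta>(3)[of k t] indicator_le_1] .
    then show ?thesis using \<eta>(2)[of k t] by (simp add: abs_mult mult_left_le)
  qed
  show "integrable lborel (\<lambda>t. f t * \<eta> k t)" for k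
    unfolding eq by (rule Bochner_Integration.integrable_bound[OF F]) (use bd in auto)
  have "(\<lambda>k. LBINT t. ?F t * \<eta> k t) \<longlonglongrightarrow> (LBINT t. ?F t)"
  proof (rule integral_dominated_convergence[where w = "\<lambda>t. norm (?F t)"])
    show "AE t in lborel. (\<lambda>k. ?F t * \<eta> k t) \<longlonglongrightarrow> ?F t"
      using AE_lborel_singleton[of p] AE_lborel_singleton[of q]
    proof eventually_elim
      case (elim t)
      have "(\<lambda>k. ?F t * \<eta> k t) \<longlonglongrightarrow> ?F t * indicator {p<..<q} t"
        by (intro tendsto_intros \<eta>)
      also have "?F t * indicator {p<..<q} t = ?F t"
        using elim by (auto simp: indicator_def)
      finally show ?case .
    qed
  qed (use F bd in auto)
  then show "(\<lambda>k. LBINT t. f t * \<eta> k t) \<longlonglongrightarrow> (LINT t:{p..q}|lborel. f t)"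
    by (simp add: eq set_lebesgue_integral_def)
qed

text \<open>Test with the primitive of the difference of the normalised indicators of the two
  intervals, smoothed; it takes values in \<open>{- 1..1}\<close> and lives on the hull of the intervals.\<close>

lemma weak_derivative_average_diff:
  assumes w: "has_weak_derivative f g" and I: "i0 < i1" "i1 \<le> j0" "j0 < j1"
  shows "\<bar>(LINT t:{i0..i1}|lborel. f t) / (i1 - i0) - (LINT t:{j0..j1}|lborel. f t) / (j1 - j0)\<bar>
    \<le> (LINT t:{i0..j1}|lborel. \<bar>g t\<bar>)"
proof -
  have fint: "set_integrable lborel {p..q} f" and gint: "set_integrable lborel {p..q} g" for p q
    using w unfolding has_weak_derivative_def by auto
  obtain \<eta> \<Phi> where \<eta>: "\<And>k. \<eta> k \<in> smooth_alg" "\<And>k t. 0 \<le> \<eta> k t"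
      "\<And>k t. \<eta> k t \<le> indicator {i0..i1} t" "\<And>t. (\<lambda>k. \<eta> k t) \<longlonglongrightarrow> indicator {i0<..<i1} t"
    and \<Phi>: "\<And>k t. (\<Phi> k has_field_derivative \<eta> k t) (at t)" "\<And>k t. t \<le> i0 \<Longrightarrow> \<Phi> k t = 0"
      "\<And>k t. t \<ge> i1 \<Longrightarrow> \<Phi> k t = \<Phi> k i1" "\<And>k s t. s \<le> t \<Longrightarrow> \<Phi> k s \<le> \<Phi> k t"
      "(\<lambda>k. \<Phi> k i1) \<longlonglongrightarrow> i1 - i0"
    by (rule smooth_indicator_approx[OF \<open>i0 < i1\<close>]) (rule that)
  obtain \<eta>' \<Phi>' where \<eta>': "\<And>k. \<eta>' k \<in> smooth_alg" "\<And>k t. 0 \<le> \<eta>' k t"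
      "\<And>k t. \<eta>' k t \<le> indicator {j0..j1} t" "\<And>t. (\<lambda>k. \<eta>' k t) \<longlonglongrightarrow> indicator {j0<..<j1} t"
    and \<Phi>': "\<And>k t. (\<Phi>' k has_field_derivative \<eta>' k t) (at t)" "\<And>k t. t \<le> j0 \<Longrightarrow> \<Phi>' k t = 0"
      "\<And>k t. t \<ge> j1 \<Longrightarrow> \<Phi>' k t = \<Phi>' k j1" "\<And>k s t. s \<le> t \<Longrightarrow> \<Phi>' k s \<le> \<Phi>' k t"
      "(\<lambda>k. \<Phi>' k j1) \<longlonglongrightarrow> j1 - j0"
    by (rule smooth_indicator_approx[OF \<open>j0 < j1\<close>]) (rule that)
  note lim = lebesgue_integral_indicator_approx[OF fint smooth_alg_measurable[OF \<eta>(1)] \<eta>(2-)]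
  note lim' = lebesgue_integral_indicator_approx[OF fint smooth_alg_measurable[OF \<eta>'(1)] \<eta>'(2-)]
  \<comment> \<open>At a fixed k the masses \<open>\<Phi> k i1\<close> and
    \<open>\<Phi>' k j1\<close> stand in for the two lengths, so that both smoothed indicators have
    integral exactly 1.\<close>
  have bound: "\<bar>(LBINT t. f t * \<eta> k t) / \<Phi> k i1 - (LBINT t. f t * \<eta>' k t) / \<Phi>' k j1\<bar>
      \<le> (LINT t:{i0..j1}|lborel. \<bar>g t\<bar>)" if Z: "\<Phi> k i1 > 0" "\<Phi>' k j1 > 0" for k
  proof -
    define \<phi> where "\<phi> t = \<Phi> k t / \<Phi> k i1 - \<Phi>' k t / \<Phi>' k j1" for t
    define \<psi> where "\<psi> t = \<eta> k t / \<Phi> k i1 - \<eta>' k t / \<Phi>' k j1" for t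
    have D: "(\<phi> has_field_derivative \<psi> t) (at t)" for t
      unfolding \<phi>_def \<psi>_def by (intro DERIV_diff DERIV_cdivide \<Phi> \<Phi>')
    have "\<psi> = (\<lambda>t. (1 / \<Phi> k i1) * \<eta> k t + (- 1 / \<Phi>' k j1) * \<eta>' k t)"
      by (auto simp: \<psi>_def)
    then have sm: "\<psi> \<in> smooth_alg"
      using smooth_add[OF smooth_mult[OF smooth_const \<eta>(1)] smooth_mult[OF smooth_const \<eta>'(1)]]
      by presburger
    \<comment> \<open>Left of \<open>i0\<close> both quotients are 0; right of \<open>j1\<close>
      both are 1 and cancel. This is where equal normalisation gives compact support.\<close>
    have supp: "\<phi> t = 0" if "t \<notin> {i0..j1}" for t
    proof (cases "t < i0")
      case True
      then show ?thesis using I \<Phi>(2)[of t k] \<Phi>'(2)[of t k] by (simp add: \<phi>_def)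
    next
      case False
      then show ?thesis using that I Z \<Phi>(3)[of t k] \<Phi>'(3)[of t k] by (simp add: \<phi>_def)
    qed
    \<comment> \<open>Comparing t with \<open>min t i0\<close> and \<open>max t i1\<close>, where
      the values of \<open>\<Phi> k\<close> are known, treats all positions of t at once.\<close>
    have r: "0 \<le> \<Phi> k t / \<Phi> k i1 \<and> \<Phi> k t / \<Phi> k i1 \<le> 1" for t
      using \<Phi>(2)[of "min t i0" k] \<Phi>(4)[of "min t i0" t k] \<Phi>(3)[of "max t i1" k]
        \<Phi>(4)[of t "max t i1" k] Z by simp
    have r': "0 \<le> \<Phi>' k t / \<Phi>' k j1 \<and> \<Phi>' k t / \<Phi>' k j1 \<le> 1" for t
      using \<Phi>'(2)[of "min t j0" k] \<Phi>'(4)[of "min t j0" t k] \<Phi>'(3)[of "max t j1" k]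
        \<Phi>'(4)[of t "max t j1" k] Z by simp
    have b: "\<bar>\<phi> t\<bar> \<le> 1" for t
      unfolding \<phi>_def using r[of t] r'[of t] by linarith
    have d: "deriv \<phi> = \<psi>" using D DERIV_imp_deriv by blast
    have "test_function \<phi>"
      using D sm supp by (rule test_function_primitive)
    then have eq: "(LBINT t. f t * \<psi> t) = - (LBINT t. g t * \<phi> t)"
      using w unfolding has_weak_derivative_def d[symmetric] by blast
    have "(LBINT t. f t * \<psi> t) =
        (LBINT t. f t * \<eta> k t / \<Phi> k i1 - f t * \<eta>' k t / \<Phi>' k j1)"
      by (simp add: \<psi>_def algebra_simps)
    also have "\<dots> = (LBINT t. f t * \<eta> k t) / \<Phi> k i1 - (LBINT t. f t * \<eta>' k t) / \<Phi>' k j1"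
      using lim(1)[of k] lim'(1)[of k] by simp
    finally have "\<bar>(LBINT t. f t * \<eta> k t) / \<Phi> k i1 - (LBINT t. f t * \<eta>' k t) / \<Phi>' k j1\<bar>
        = \<bar>LBINT t. g t * \<phi> t\<bar>"
      using eq by simp
    also have "\<dots> \<le> (LBINT t. \<bar>g t * \<phi> t\<bar>)"
      by (rule integral_abs_bound)
    also have "\<dots> \<le> (LINT t:{i0..j1}|lborel. \<bar>g t\<bar>)"
      unfolding set_lebesgue_integral_def
    proof (rule integral_mono')
      show "integrable lborel (\<lambda>t. indicator {i0..j1} t *\<^sub>R \<bar>g t\<bar>)"
        using set_integrable_abs[OF gint] by (simp add: set_integrable_def)
      show "\<bar>g t * \<phi> t\<bar> \<le> indicator {i0..j1} t *\<^sub>R \<bar>g t\<bar>" for t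
        using b[of t] supp[of t] by (auto simp: indicator_def abs_mult mult_left_le)
    qed simp
    finally show ?thesis .
  qed
  have "\<forall>\<^sub>F k in sequentially. \<Phi> k i1 > 0" "\<forall>\<^sub>F k in sequentially. \<Phi>' k j1 > 0"
    using order_tendstoD(1)[OF \<Phi>(5), of 0] order_tendstoD(1)[OF \<Phi>'(5), of 0] I by auto
  then have ev: "\<forall>\<^sub>F k in sequentially.
      \<bar>(LBINT t. f t * \<eta> k t) / \<Phi> k i1 - (LBINT t. f t * \<eta>' k t) / \<Phi>' k j1\<bar>
      \<le> (LINT t:{i0..j1}|lborel. \<bar>g t\<bar>)"
    by eventually_elim (rule bound)
  have "(\<lambda>k. \<bar>(LBINT t. f t * \<eta> k t) / \<Phi> k i1 - (LBINT t. f t * \<eta>' k t) / \<Phi>' k j1\<bar>) \<longlonglongrightarrow>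
     \<bar>(LINT t:{i0..i1}|lborel. f t) / (i1 - i0) - (LINT t:{j0..j1}|lborel. f t) / (j1 - j0)\<bar>"
    using I by (intro tendsto_rabs tendsto_diff tendsto_divide lim(2) lim'(2) \<Phi>(5) \<Phi>'(5)) auto
  then show ?thesis
    by (rule tendsto_upperbound[OF _ ev]) simp
qed

text \<open>Let the two intervals of the average estimate shrink to x and y: by Lebesgue
  differentiation the averages converge to f x and f y off a null set, which serves all pairs x, y
  simultaneously.\<close>

lemma weak_derivative_pointwise_diff:
  assumes w: "has_weak_derivative f g"
  obtains N where "negligible N"
    and "\<And>x y. x \<notin> N \<Longrightarrow> y \<notin> N \<Longrightarrow> x \<le> y \<Longrightarrow> \<bar>f x - f y\<bar> \<le> (LINT t:{x..y}|lborel. \<bar>g t\<bar>)"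
proof -
  have fint: "set_integrable lborel {p..q} f" and gint: "set_integrable lborel {p..q} g" for p q
    using w unfolding has_weak_derivative_def by auto
  have "f integrable_on cbox p q" for p q
    using set_borel_integral_eq_integral(1)[OF fint] by simp
  \<comment> \<open>Lebesgue's differentiation theorem for the one-sided intervals {x..x +
    h}.\<close>
  then obtain N where N: "negligible N" and "\<And>x e. \<lbrakk>x \<notin> N; 0 < e\<rbrakk> \<Longrightarrow>
      \<exists>d>0. \<forall>h. 0 < h \<and> h < d \<longrightarrow>
        norm (integral (cbox x (x + h *\<^sub>R One)) f /\<^sub>R h ^ DIM(real) - f x) < e"
    using integrable_ccontinuous_explicit[of f] by metis
  then have 1: "\<exists>d>0. \<forall>h. 0 < h \<and> h < d \<longrightarrow> \<bar>(LINT t:{x..x+h}|lborel. f t) / h - f x\<bar> < e"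
    if "x \<notin> N" "0 < e" for x e
    using that by (simp add: set_borel_integral_eq_integral(2)[OF fint] divide_inverse mult.commute)
  define e :: "nat \<Rightarrow> real" where "e k = inverse (Suc k)" for k
  have e0: "e \<longlonglongrightarrow> 0" and epos: "e k > 0" for k
    unfolding e_def by (rule LIMSEQ_inverse_real_of_nat) auto
  have lim: "(\<lambda>k. (LINT t:{x..x + e k}|lborel. f t) / e k) \<longlonglongrightarrow> f x" if x: "x \<notin> N" for x
  proof (rule tendstoI)
    fix r :: real assume "r > 0"
    then obtain d where d: "d > 0"
      "\<And>h. 0 < h \<Longrightarrow> h < d \<Longrightarrow> \<bar>(LINT t:{x..x+h}|lborel. f t) / h - f x\<bar> < r"
      using 1[OF x] by metis
    show "\<forall>\<^sub>F k in sequentially. dist ((LINT t:{x..x + e k}|lborel. f t) / e k) (f x) < r"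
      using order_tendstoD(2)[OF e0 d(1)]
      by eventually_elim (use d epos in \<open>auto simp: dist_real_def\<close>)
  qed
  have "\<bar>f x - f y\<bar> \<le> (LINT t:{x..y}|lborel. \<bar>g t\<bar>)"
    if x: "x \<notin> N" and y: "y \<notin> N" and xy: "x < y" for x y
  proof -
    \<comment> \<open>The average estimate needs the interval at x to end before the one at y
      begins, which holds once \<open>e k < y - x\<close>.\<close>
    have ev: "\<forall>\<^sub>F k in sequentially. \<bar>(LINT t:{x..x + e k}|lborel. f t) / e k
        - (LINT t:{y..y + e k}|lborel. f t) / e k\<bar> \<le> (LINT t:{x..y + e k}|lborel. \<bar>g t\<bar>)"
    proof (rule eventually_mono)
      show "\<forall>\<^sub>F k in sequentially. e k < y - x"
        using order_tendstoD(2)[OF e0, of "y - x"] xy by simp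
      fix k assume "e k < y - x"
      then show "\<bar>(LINT t:{x..x + e k}|lborel. f t) / e k
        - (LINT t:{y..y + e k}|lborel. f t) / e k\<bar> \<le> (LINT t:{x..y + e k}|lborel. \<bar>g t\<bar>)"
        using weak_derivative_average_diff[OF w, of x "x + e k" y "y + e k"] epos[of k] by simp
    qed
    \<comment> \<open>The integrand at each t is eventually constant: from the start if t \<le> y,
      and once \<open>e k < t - y\<close> otherwise. The majorant lives on {x..y + 1} because
      \<open>e k\<close> is at most 1.\<close>
    have "(\<lambda>k. LINT t:{x..y + e k}|lborel. \<bar>g t\<bar>) \<longlonglongrightarrow> (LINT t:{x..y}|lborel. \<bar>g t\<bar>)"
      unfolding set_lebesgue_integral_def
    proof (rule integral_dominated_convergence[where w = "\<lambda>t. indicator {x..y + 1} t *\<^sub>R \<bar>g t\<bar>"])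
      have m: "(\<lambda>t. indicator {x..q} t *\<^sub>R \<bar>g t\<bar>) \<in> borel_measurable lborel" for q
        using set_integrable_abs[OF gint[of x q]] unfolding set_integrable_def by auto
      show "(\<lambda>t. indicator {x..y} t *\<^sub>R \<bar>g t\<bar>) \<in> borel_measurable lborel"
        "(\<lambda>t. indicator {x..y + e k} t *\<^sub>R \<bar>g t\<bar>) \<in> borel_measurable lborel" for k
        by (rule m)+
      show "integrable lborel (\<lambda>t. indicator {x..y + 1} t *\<^sub>R \<bar>g t\<bar>)"
        using set_integrable_abs[OF gint] by (simp add: set_integrable_def)
      have "e k \<le> 1" for k
        by (simp add: e_def inverse_le_1_iff)
      then have "y + e k \<le> y + 1" for k by simp
      then show "AE t in lborel. norm (indicator {x..y + e k} t *\<^sub>R \<bar>g t\<bar>)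
          \<le> indicator {x..y + 1} t *\<^sub>R \<bar>g t\<bar>" for k
        by (intro AE_I2) (auto simp: indicator_def intro: order_trans[of _ "y + e k"])
      show "AE t in lborel. (\<lambda>k. indicator {x..y + e k} t *\<^sub>R \<bar>g t\<bar>)
          \<longlonglongrightarrow> indicator {x..y} t *\<^sub>R \<bar>g t\<bar>"
      proof (intro AE_I2 tendsto_eventually)
        fix t
        show "\<forall>\<^sub>F k in sequentially.
            indicator {x..y + e k} t *\<^sub>R \<bar>g t\<bar> = indicator {x..y} t *\<^sub>R \<bar>g t\<bar>"
        proof (cases "t \<le> y")
          case True
          then show ?thesis
            using epos by (intro always_eventually allI) (auto simp: indicator_def intro: add_increasing2 less_imp_le)
        next
          case False
          then show ?thesis
            by (intro eventually_mono[OF order_tendstoD(2)[OF e0, of "t - y"]]) (auto simp: indicator_def)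
        qed
      qed
    qed
    moreover have "(\<lambda>k. \<bar>(LINT t:{x..x + e k}|lborel. f t) / e k
        - (LINT t:{y..y + e k}|lborel. f t) / e k\<bar>) \<longlonglongrightarrow> \<bar>f x - f y\<bar>"
      by (intro tendsto_intros lim x y)
    ultimately show ?thesis
      using ev by (intro tendsto_le) auto
  qed
  then have "\<bar>f x - f y\<bar> \<le> (LINT t:{x..y}|lborel. \<bar>g t\<bar>)"
    if "x \<notin> N" "y \<notin> N" "x \<le> y" for x y
    using that by (cases "x = y") (auto simp: set_lebesgue_integral_def)
  with N show thesis by (rule that)
qed

section \<open>The moving window estimate\<close>

lemma borel_measurable_moving_window:
  fixes h :: "real \<Rightarrow> ennreal"
  assumes [measurable]: "h \<in> borel_measurable borel"
  shows "(\<lambda>x. \<integral>\<^sup>+y. h y * indicator {x - b..x - a} y \<partial>lborel) \<in> borel_measurable borel"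
proof -
  have "(\<lambda>x. \<integral>\<^sup>+y. (if x - b \<le> y \<and> y \<le> x - a then h y else 0) \<partial>lborel)
      \<in> borel_measurable lborel"
    by (rule lborel.borel_measurable_nn_integral) measurable
  moreover have "h y * indicator {x - b..x - a} y = (if x - b \<le> y \<and> y \<le> x - a then h y else 0)" for x y
    by (auto simp: indicator_def)
  ultimately show ?thesis by simp
qed

text \<open>Exchange the integrals: a given y lies in the window of x exactly when x lies in {y +
  a..y + b}, a set of length b - a.\<close>

lemma nn_integral_moving_window:
  fixes h :: "real \<Rightarrow> ennreal"
  assumes [measurable]: "h \<in> borel_measurable borel" and "a \<le> b"
  shows "(\<integral>\<^sup>+x. \<integral>\<^sup>+y. h y * indicator {x - b..x - a} y \<partial>lborel \<partial>lborel)
    = ennreal (b - a) * (\<integral>\<^sup>+y. h y \<partial>lborel)"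
proof -
  have eq: "h y * indicator {x - b..x - a} y = (if x - b \<le> y \<and> y \<le> x - a then h y else 0)" for x y
    by (auto simp: indicator_def)
  have "(\<integral>\<^sup>+x. \<integral>\<^sup>+y. h y * indicator {x - b..x - a} y \<partial>lborel \<partial>lborel) =
      (\<integral>\<^sup>+y. \<integral>\<^sup>+x. h y * indicator {x - b..x - a} y \<partial>lborel \<partial>lborel)"
    unfolding eq by (rule lborel_pair.Fubini'[symmetric]) measurable
  also have "\<dots> = (\<integral>\<^sup>+y. \<integral>\<^sup>+x. h y * indicator {y + a..y + b} x \<partial>lborel \<partial>lborel)"
    by (intro nn_integral_cong) (auto simp: indicator_def)
  also have "\<dots> = (\<integral>\<^sup>+y. h y * ennreal (b - a) \<partial>lborel)"
    using assms(2) by (intro nn_integral_cong) (simp add: nn_integral_cmult)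
  also have "\<dots> = ennreal (b - a) * (\<integral>\<^sup>+y. h y \<partial>lborel)"
    by (simp add: nn_integral_multc mult.commute)
  finally show ?thesis .
qed

lemma ennreal_sum_power2_le:
  fixes x y :: ennreal
  shows "(x + y)\<^sup>2 \<le> 2 * x\<^sup>2 + 2 * y\<^sup>2"
proof (cases x; cases y)
  fix r s :: real assume *: "x = ennreal r" "0 \<le> r" "y = ennreal s" "0 \<le> s"
  have "(r + s)\<^sup>2 \<le> 2 * r\<^sup>2 + 2 * s\<^sup>2"
    using sum_squares_bound[of r s] by (simp add: power2_sum)
  then have "ennreal ((r + s)\<^sup>2) \<le> ennreal (2 * r\<^sup>2 + 2 * s\<^sup>2)"
    by (rule ennreal_leI)
  also have "\<dots> = 2 * ennreal (r\<^sup>2) + 2 * ennreal (s\<^sup>2)"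
    by (simp add: ennreal_mult')
  also have "ennreal ((r + s)\<^sup>2) = (x + y)\<^sup>2"
    using * by (simp add: ennreal_power[symmetric])
  finally show ?thesis
    using * by (simp add: ennreal_power)
qed (auto simp: power2_eq_square ennreal_mult_top ennreal_top_mult)

text \<open>\<open>B\<close> bounds the loss in comparing x with the averaging window,
  \<open>K\<close> the loss along the whole path from the window to x. The assumption on F is the
  pointwise bound off N rather than weak differentiability, so that it passes easily to reflected
  functions. Working in \<open>ennreal\<close> allows any of the integrals to be infinite.\<close>

lemma half_line_estimate:
  fixes F G \<omega> \<tau> :: "real \<Rightarrow> real"
  assumes [measurable]: "F \<in> borel_measurable borel" "G \<in> borel_measurable borel"
      "\<omega> \<in> borel_measurable borel" "\<tau> \<in> borel_measurable borel"
    and nn: "\<And>x. 0 \<le> \<omega> x" "\<And>x. 0 \<le> \<tau> x" and "0 < \<delta>" "0 \<le> B" "0 \<le> K"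
    and N: "AE x in lborel. x \<notin> N"
    and diff: "\<And>x y. x \<notin> N \<Longrightarrow> y \<notin> N \<Longrightarrow> y \<le> x \<Longrightarrow>
      ennreal \<bar>F x\<bar> \<le> ennreal \<bar>F y\<bar> + (\<integral>\<^sup>+s. ennreal \<bar>G s\<bar> * indicator {y..x} s \<partial>lborel)"
    and B: "\<And>x y. 0 \<le> x \<Longrightarrow> x - 2 * \<delta> \<le> y \<Longrightarrow> y \<le> x - \<delta> \<Longrightarrow> \<omega> x \<le> B * (\<tau> y * \<omega> y)"
    and K: "\<And>x s. 0 \<le> x \<Longrightarrow> x - 2 * \<delta> \<le> s \<Longrightarrow> s \<le> x \<Longrightarrow> \<omega> x \<le> K * \<omega> s"
  shows "(\<integral>\<^sup>+x. ennreal ((\<omega> x * F x)\<^sup>2) * indicator {0..} x \<partial>lborel) \<le>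
    ennreal (2 * B\<^sup>2 / \<delta>) * (\<integral>\<^sup>+x. ennreal (\<tau> x * \<omega> x * \<bar>F x\<bar>) \<partial>lborel)\<^sup>2
    + ennreal (8 * K\<^sup>2 * \<delta>\<^sup>2) * (\<integral>\<^sup>+x. ennreal ((\<omega> x * G x)\<^sup>2) \<partial>lborel)"
proof -
  define w where "w x = ennreal (\<tau> x * \<omega> x * \<bar>F x\<bar>)" for x
  define v where "v x = ennreal (\<omega> x * \<bar>G x\<bar>)" for x
  have [measurable]: "w \<in> borel_measurable borel" "v \<in> borel_measurable borel"
    unfolding w_def v_def by measurable
  define P where "P x = (\<integral>\<^sup>+y. w y * indicator {x - 2 * \<delta>..x - \<delta>} y \<partial>lborel)" for x
  \<comment> \<open>The form \<open>x - 0\<close> matches the lemmas on moving windows with a =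
    0.\<close>
  define I where "I x = (\<integral>\<^sup>+y. v y * indicator {x - 2 * \<delta>..x - 0} y \<partial>lborel)" for x
  define J where "J x = (\<integral>\<^sup>+y. (v y)\<^sup>2 * indicator {x - 2 * \<delta>..x - 0} y \<partial>lborel)" for x
  have [measurable]: "P \<in> borel_measurable borel" "J \<in> borel_measurable borel"
    unfolding P_def J_def by (rule borel_measurable_moving_window; measurable)+
  define w0 where "w0 = (\<integral>\<^sup>+x. w x \<partial>lborel)"
  define E0 where "E0 = (\<integral>\<^sup>+x. (v x)\<^sup>2 \<partial>lborel)"
  have pw: "ennreal (\<omega> x * \<bar>F x\<bar>) \<le> ennreal (B / \<delta>) * P x + ennreal K * I x"
    if x: "x \<notin> N" "0 \<le> x" for x
  proof -
    let ?i = "indicator {x - 2 * \<delta>..x - \<delta>} :: real \<Rightarrow> ennreal"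
    have 1: "ennreal (\<omega> x * \<bar>F x\<bar>) \<le> ennreal B * w y + ennreal K * I x"
      if y: "y \<notin> N" "x - 2 * \<delta> \<le> y" "y \<le> x - \<delta>" for y
    proof -
      have "y \<le> x" using y \<open>0 < \<delta>\<close> by simp
      have "ennreal (\<omega> x * \<bar>F x\<bar>) = ennreal (\<omega> x) * ennreal \<bar>F x\<bar>"
        using nn by (simp add: ennreal_mult)
      also have "\<dots> \<le> ennreal (\<omega> x) * (ennreal \<bar>F y\<bar> +
          (\<integral>\<^sup>+s. ennreal \<bar>G s\<bar> * indicator {y..x} s \<partial>lborel))"
        by (intro mult_left_mono diff x y \<open>y \<le> x\<close>) simp
      also have "\<dots> = ennreal (\<omega> x * \<bar>F y\<bar>) +
          (\<integral>\<^sup>+s. ennreal (\<omega> x * \<bar>G s\<bar>) * indicator {y..x} s \<partial>lborel)"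
        using nn by (simp add: distrib_left ennreal_mult nn_integral_cmult[symmetric] mult.assoc)
      also have "\<dots> \<le> ennreal B * w y + ennreal K * I x"
      proof (rule add_mono)
        have "\<omega> x * \<bar>F y\<bar> \<le> B * (\<tau> y * \<omega> y) * \<bar>F y\<bar>"
          by (intro mult_right_mono B x y) simp
        then show "ennreal (\<omega> x * \<bar>F y\<bar>) \<le> ennreal B * w y"
          using \<open>0 \<le> B\<close> nn by (simp add: w_def ennreal_mult[symmetric] ennreal_leI mult.assoc)
        have "(\<integral>\<^sup>+s. ennreal (\<omega> x * \<bar>G s\<bar>) * indicator {y..x} s \<partial>lborel) \<le>
            (\<integral>\<^sup>+s. ennreal K * (v s * indicator {x - 2 * \<delta>..x - 0} s) \<partial>lborel)"
        proof (rule nn_integral_mono)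
          fix s
          show "ennreal (\<omega> x * \<bar>G s\<bar>) * indicator {y..x} s
              \<le> ennreal K * (v s * indicator {x - 2 * \<delta>..x - 0} s)"
          proof (cases "s \<in> {y..x}")
            case True
            then have s: "x - 2 * \<delta> \<le> s" "s \<le> x" using y by auto
            have "\<omega> x * \<bar>G s\<bar> \<le> K * \<omega> s * \<bar>G s\<bar>"
              by (intro mult_right_mono K x s) simp
            then show ?thesis
              using True s \<open>0 \<le> K\<close> nn by (simp add: v_def ennreal_mult[symmetric] ennreal_leI mult.assoc)
          qed simp
        qed
        also have "\<dots> = ennreal K * I x"
          unfolding I_def by (rule nn_integral_cmult) measurable
        finally show "(\<integral>\<^sup>+s. ennreal (\<omega> x * \<bar>G s\<bar>) * indicator {y..x} s \<partial>lborel) \<le> ennreal K * I x" .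
      qed
      finally show ?thesis .
    qed
    \<comment> \<open>The window has length \<delta>, so its indicator divided by \<delta> is a
      probability density. Integrating a bound in y against it is averaging; c may be
      infinite.\<close>
    have len: "(\<integral>\<^sup>+y. c * (ennreal (1 / \<delta>) * ?i y) \<partial>lborel) = c" for c
    proof -
      have "(\<integral>\<^sup>+y. c * (ennreal (1 / \<delta>) * ?i y) \<partial>lborel) = c * (ennreal (1 / \<delta>) * ennreal \<delta>)"
        using \<open>0 < \<delta>\<close> by (simp add: nn_integral_cmult)
      also have "ennreal (1 / \<delta>) * ennreal \<delta> = 1"
        using \<open>0 < \<delta>\<close> by (simp add: ennreal_mult[symmetric])
      finally show ?thesis by simp
    qed
    have "ennreal (\<omega> x * \<bar>F x\<bar>) = (\<integral>\<^sup>+y. ennreal (\<omega> x * \<bar>F x\<bar>) * (ennreal (1 / \<delta>) * ?i y) \<partial>lborel)"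
      by (rule len[symmetric])
    also have "\<dots> \<le> (\<integral>\<^sup>+y. ennreal (B / \<delta>) * (w y * ?i y)
        + (ennreal K * I x) * (ennreal (1 / \<delta>) * ?i y) \<partial>lborel)"
    proof (rule nn_integral_mono_AE)
      show "AE y in lborel. ennreal (\<omega> x * \<bar>F x\<bar>) * (ennreal (1 / \<delta>) * ?i y) \<le>
          ennreal (B / \<delta>) * (w y * ?i y) + (ennreal K * I x) * (ennreal (1 / \<delta>) * ?i y)"
        using N
      proof eventually_elim
        case (elim y)
        have Bd: "ennreal (B / \<delta>) = ennreal B * ennreal (1 / \<delta>)"
          using \<open>0 \<le> B\<close> \<open>0 < \<delta>\<close> by (simp add: ennreal_mult[symmetric])
        show ?case
        proof (cases "y \<in> {x - 2 * \<delta>..x - \<delta>}")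
          case True
          then have "ennreal (\<omega> x * \<bar>F x\<bar>) * ennreal (1 / \<delta>) \<le>
              (ennreal B * w y + ennreal K * I x) * ennreal (1 / \<delta>)"
            by (intro mult_right_mono 1 elim) auto
          then show ?thesis
            using True by (simp add: Bd distrib_left distrib_right mult_ac)
        qed simp
      qed
    qed
    also have "\<dots> = (\<integral>\<^sup>+y. ennreal (B / \<delta>) * (w y * ?i y) \<partial>lborel) +
        (\<integral>\<^sup>+y. (ennreal K * I x) * (ennreal (1 / \<delta>) * ?i y) \<partial>lborel)"
      by (rule nn_integral_add) measurable
    also have "\<dots> = ennreal (B / \<delta>) * P x + ennreal K * I x"
      unfolding len by (simp add: P_def nn_integral_cmult)
    finally show ?thesis .
  qed
  \<comment> \<open>Only one of the two factors \<open>P x\<close> is bounded by the full integral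
    \<open>w0\<close>. The other is kept and integrated over x, which gains a factor \<delta>
    against the 1/\<delta>^2 from averaging.\<close>
  have P2: "(P x)\<^sup>2 \<le> w0 * P x" for x
    unfolding power2_eq_square
    by (intro mult_right_mono) (auto simp: P_def w0_def intro!: nn_integral_mono simp: indicator_def)
  \<comment> \<open>Cauchy-Schwarz on an interval of length 2\<delta>; the integration of
    \<open>J\<close> over x yields the second factor 2\<delta>, hence \<delta>^2 in front of the
    energy.\<close>
  have I2: "(I x)\<^sup>2 \<le> ennreal (2 * \<delta>) * J x" for x
  proof -
    let ?i = "indicator {x - 2 * \<delta>..x - 0} :: real \<Rightarrow> ennreal"
    have sq: "(?i y)\<^sup>2 = ?i y" "(v y * ?i y)\<^sup>2 = (v y)\<^sup>2 * ?i y" for y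
      by (auto simp: indicator_def)
    have "(I x)\<^sup>2 = (\<integral>\<^sup>+y. (v y * ?i y) * ?i y \<partial>lborel)\<^sup>2"
      unfolding I_def by (intro arg_cong[of _ _ "\<lambda>x. x\<^sup>2"] nn_integral_cong) (auto simp: indicator_def)
    also have "\<dots> \<le> (\<integral>\<^sup>+y. (v y * ?i y)\<^sup>2 \<partial>lborel) * (\<integral>\<^sup>+y. (?i y)\<^sup>2 \<partial>lborel)"
      by (rule Cauchy_Schwarz_nn_integral) measurable
    also have "\<dots> = ennreal (2 * \<delta>) * J x"
      unfolding sq J_def using \<open>0 < \<delta>\<close> by (simp add: mult.commute)
    finally show ?thesis .
  qed
  have sq: "ennreal ((\<omega> x * F x)\<^sup>2) * indicator {0..} x \<le>
      ennreal (2 * (B / \<delta>)\<^sup>2) * w0 * P x + ennreal (4 * K\<^sup>2 * \<delta>) * J x" if "x \<notin> N" for x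
  proof (cases "0 \<le> x")
    case True
    have "ennreal ((\<omega> x * F x)\<^sup>2) = (ennreal (\<omega> x * \<bar>F x\<bar>))\<^sup>2"
      using nn by (simp add: ennreal_power power_mult_distrib)
    also have "\<dots> \<le> (ennreal (B / \<delta>) * P x + ennreal K * I x)\<^sup>2"
      by (intro power_mono pw that True) simp
    also have "\<dots> \<le> 2 * (ennreal (B / \<delta>) * P x)\<^sup>2 + 2 * (ennreal K * I x)\<^sup>2"
      by (rule ennreal_sum_power2_le)
    also have "\<dots> = ennreal (2 * (B / \<delta>)\<^sup>2) * (P x)\<^sup>2 + ennreal (2 * K\<^sup>2) * (I x)\<^sup>2"
      using \<open>0 \<le> B\<close> \<open>0 < \<delta>\<close> \<open>0 \<le> K\<close>
      by (simp add: power_mult_distrib ennreal_power ennreal_mult mult.assoc)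
    also have "\<dots> \<le> ennreal (2 * (B / \<delta>)\<^sup>2) * (w0 * P x) + ennreal (2 * K\<^sup>2) * (ennreal (2 * \<delta>) * J x)"
      by (intro add_mono mult_left_mono P2 I2) auto
    also have "\<dots> = ennreal (2 * (B / \<delta>)\<^sup>2) * w0 * P x + ennreal (4 * K\<^sup>2 * \<delta>) * J x"
    proof -
      have "ennreal (2 * K\<^sup>2) * ennreal (2 * \<delta>) = ennreal (4 * K\<^sup>2 * \<delta>)"
        using \<open>0 < \<delta>\<close> by (simp add: ennreal_mult[symmetric])
      then show ?thesis by (simp add: mult.assoc[symmetric])
    qed
    finally show ?thesis using True by simp
  qed simp
  have "(\<integral>\<^sup>+x. ennreal ((\<omega> x * F x)\<^sup>2) * indicator {0..} x \<partial>lborel) \<le>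
      (\<integral>\<^sup>+x. ennreal (2 * (B / \<delta>)\<^sup>2) * w0 * P x + ennreal (4 * K\<^sup>2 * \<delta>) * J x \<partial>lborel)"
    by (rule nn_integral_mono_AE) (rule eventually_mono[OF N sq])
  also have "\<dots> = ennreal (2 * (B / \<delta>)\<^sup>2) * w0 * (\<integral>\<^sup>+x. P x \<partial>lborel)
      + ennreal (4 * K\<^sup>2 * \<delta>) * (\<integral>\<^sup>+x. J x \<partial>lborel)"
    by (simp add: nn_integral_add nn_integral_cmult)
  also have "(\<integral>\<^sup>+x. P x \<partial>lborel) = ennreal \<delta> * w0"
    unfolding P_def w0_def using nn_integral_moving_window[of w \<delta> "2 * \<delta>"] \<open>0 < \<delta>\<close> by simp
  also have "(\<integral>\<^sup>+x. J x \<partial>lborel) = ennreal (2 * \<delta>) * E0"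
    unfolding J_def E0_def using nn_integral_moving_window[of "\<lambda>x. (v x)\<^sup>2" 0 "2 * \<delta>"] \<open>0 < \<delta>\<close> by simp
  also have "ennreal (2 * (B / \<delta>)\<^sup>2) * w0 * (ennreal \<delta> * w0) = ennreal (2 * B\<^sup>2 / \<delta>) * w0\<^sup>2"
  proof -
    have "ennreal (2 * (B / \<delta>)\<^sup>2) * w0 * (ennreal \<delta> * w0) =
        (ennreal (2 * (B / \<delta>)\<^sup>2) * ennreal \<delta>) * w0\<^sup>2"
      by (simp add: power2_eq_square mult_ac)
    also have "ennreal (2 * (B / \<delta>)\<^sup>2) * ennreal \<delta> = ennreal (2 * B\<^sup>2 / \<delta>)"
      using \<open>0 < \<delta>\<close> by (simp add: ennreal_mult[symmetric] power2_eq_square)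
    finally show ?thesis .
  qed
  also have "ennreal (4 * K\<^sup>2 * \<delta>) * (ennreal (2 * \<delta>) * E0) = ennreal (8 * K\<^sup>2 * \<delta>\<^sup>2) * E0"
  proof -
    have "ennreal (4 * K\<^sup>2 * \<delta>) * ennreal (2 * \<delta>) = ennreal (8 * K\<^sup>2 * \<delta>\<^sup>2)"
    proof -
      have "ennreal (4 * K\<^sup>2 * \<delta>) * ennreal (2 * \<delta>) = ennreal (4 * K\<^sup>2 * \<delta> * (2 * \<delta>))"
        using \<open>0 < \<delta>\<close> by (intro ennreal_mult[symmetric]) auto
      then show ?thesis by (simp add: power2_eq_square mult_ac)
    qed
    then show ?thesis by (simp add: mult.assoc[symmetric])
  qed
  also have "E0 = (\<integral>\<^sup>+x. ennreal ((\<omega> x * G x)\<^sup>2) \<partial>lborel)"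
    unfolding E0_def v_def using nn by (simp add: ennreal_power power_mult_distrib)
  finally show ?thesis unfolding w0_def w_def .
qed

text \<open>The half-line estimate is applied to F and to its reflection. Evenness of the weights
  makes both right-hand sides equal, and adding them doubles the constants.\<close>

lemma line_estimate:
  fixes F G \<omega> \<tau> :: "real \<Rightarrow> real"
  assumes [measurable]: "F \<in> borel_measurable borel" "G \<in> borel_measurable borel"
      "\<omega> \<in> borel_measurable borel" "\<tau> \<in> borel_measurable borel"
    and nn: "\<And>x. 0 \<le> \<omega> x" "\<And>x. 0 \<le> \<tau> x" and "0 < \<delta>" "0 \<le> B" "0 \<le> K"
    and even: "\<And>x. \<omega> (- x) = \<omega> x" "\<And>x. \<tau> (- x) = \<tau> x"
    and FG: "has_weak_derivative F G"
    and B: "\<And>x y. 0 \<le> x \<Longrightarrow> x - 2 * \<delta> \<le> y \<Longrightarrow> y \<le> x - \<delta> \<Longrightarrow> \<omega> x \<le> B * (\<tau> y * \<omega> y)"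
    and K: "\<And>x s. 0 \<le> x \<Longrightarrow> x - 2 * \<delta> \<le> s \<Longrightarrow> s \<le> x \<Longrightarrow> \<omega> x \<le> K * \<omega> s"
  shows "(\<integral>\<^sup>+x. ennreal ((\<omega> x * F x)\<^sup>2) \<partial>lborel) \<le>
    ennreal (4 * B\<^sup>2 / \<delta>) * (\<integral>\<^sup>+x. ennreal (\<tau> x * \<omega> x * \<bar>F x\<bar>) \<partial>lborel)\<^sup>2
    + ennreal (16 * K\<^sup>2 * \<delta>\<^sup>2) * (\<integral>\<^sup>+x. ennreal ((\<omega> x * G x)\<^sup>2) \<partial>lborel)"
proof -
  obtain N0 where "negligible N0" and N0: "\<And>x y. x \<notin> N0 \<Longrightarrow> y \<notin> N0 \<Longrightarrow> x \<le> y \<Longrightarrow>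
      \<bar>F x - F y\<bar> \<le> (LINT t:{x..y}|lborel. \<bar>G t\<bar>)"
    using weak_derivative_pointwise_diff[OF FG] by blast
  then have "AE x in lebesgue. x \<notin> N0"
    by (simp add: negligible_iff_null_sets AE_not_in)
  then have "AE x in lborel. x \<notin> N0"
    by (simp only: AE_completion_iff)
  \<comment> \<open>The exceptional set is only Lebesgue null; it is enlarged to a Borel null set so
    that its reflection can be handled through the affine invariance of
    \<open>lborel\<close>.\<close>
  then obtain N where N: "N \<in> null_sets lborel" "N0 \<subseteq> N"
    by (rule AE_E3) (use that in fastforce)
  have dist: "ennreal \<bar>F x - F y\<bar> \<le> (\<integral>\<^sup>+s. ennreal \<bar>G s\<bar> * indicator {x..y} s \<partial>lborel)"
    if "x \<notin> N" "y \<notin> N" "x \<le> y" for x y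
  proof -
    have "set_integrable lborel {x..y} G"
      using FG unfolding has_weak_derivative_def by auto
    then have "integrable lborel (\<lambda>t. indicator {x..y} t *\<^sub>R \<bar>G t\<bar>)"
      using set_integrable_abs by (fastforce simp: set_integrable_def)
    then have "ennreal (LINT t:{x..y}|lborel. \<bar>G t\<bar>) =
        (\<integral>\<^sup>+s. ennreal (indicator {x..y} s *\<^sub>R \<bar>G s\<bar>) \<partial>lborel)"
      unfolding set_lebesgue_integral_def by (intro nn_integral_eq_integral[symmetric]) auto
    also have "\<dots> = (\<integral>\<^sup>+s. ennreal \<bar>G s\<bar> * indicator {x..y} s \<partial>lborel)"
      by (intro nn_integral_cong) (auto simp: indicator_def)
    finally show ?thesis
      using N0[of x y] that N(2) by (metis ennreal_leI subsetD)
  qed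
  have tri: "ennreal \<bar>r\<bar> \<le> ennreal \<bar>s\<bar> + C" if "ennreal \<bar>r - s\<bar> \<le> C" for r s :: real and C
  proof -
    have "ennreal \<bar>r\<bar> \<le> ennreal (\<bar>s\<bar> + \<bar>r - s\<bar>)"
      by (rule ennreal_leI) linarith
    also have "\<dots> \<le> ennreal \<bar>s\<bar> + C"
      using that by (simp add: add_left_mono)
    finally show ?thesis .
  qed
  have N_AE: "AE x in lborel. x \<notin> N" by (rule AE_not_in[OF N(1)])
  have [measurable]: "N \<in> sets borel" using N(1) by auto
  have N_AE': "AE x in lborel. x \<notin> uminus -` N"
    using AE_borel_affine[of "-1" "\<lambda>x. x \<notin> N" 0] N_AE by simp
  have refl: "(\<integral>\<^sup>+x. h (- x) \<partial>lborel) = (\<integral>\<^sup>+x. h x \<partial>lborel)"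
    if "h \<in> borel_measurable borel" for h :: "real \<Rightarrow> ennreal"
    using nn_integral_real_affine[OF that, of "-1" 0] by simp
  let ?W = "\<integral>\<^sup>+x. ennreal (\<tau> x * \<omega> x * \<bar>F x\<bar>) \<partial>lborel"
  let ?E = "\<integral>\<^sup>+x. ennreal ((\<omega> x * G x)\<^sup>2) \<partial>lborel"
  let ?R = "ennreal (2 * B\<^sup>2 / \<delta>) * ?W\<^sup>2 + ennreal (8 * K\<^sup>2 * \<delta>\<^sup>2) * ?E"
  have right: "(\<integral>\<^sup>+x. ennreal ((\<omega> x * F x)\<^sup>2) * indicator {0..} x \<partial>lborel) \<le> ?R"
  proof (rule half_line_estimate[OF _ _ _ _ nn \<open>0 < \<delta>\<close> \<open>0 \<le> B\<close> \<open>0 \<le> K\<close> N_AE _ B K])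
    fix x y assume "x \<notin> N" "y \<notin> N" "y \<le> x"
    then show "ennreal \<bar>F x\<bar> \<le> ennreal \<bar>F y\<bar> + (\<integral>\<^sup>+s. ennreal \<bar>G s\<bar> * indicator {y..x} s \<partial>lborel)"
      using dist[of y x] by (intro tri) (simp add: abs_minus_commute)
  qed auto
  have "(\<integral>\<^sup>+x. ennreal ((\<omega> x * F (- x))\<^sup>2) * indicator {0..} x \<partial>lborel) \<le>
     ennreal (2 * B\<^sup>2 / \<delta>) * (\<integral>\<^sup>+x. ennreal (\<tau> x * \<omega> x * \<bar>F (- x)\<bar>) \<partial>lborel)\<^sup>2
     + ennreal (8 * K\<^sup>2 * \<delta>\<^sup>2) * (\<integral>\<^sup>+x. ennreal ((\<omega> x * G (- x))\<^sup>2) \<partial>lborel)"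
  proof (rule half_line_estimate[OF _ _ _ _ nn \<open>0 < \<delta>\<close> \<open>0 \<le> B\<close> \<open>0 \<le> K\<close> N_AE' _ B K])
    fix x y assume *: "x \<notin> uminus -` N" "y \<notin> uminus -` N" "y \<le> x"
    have "(\<integral>\<^sup>+s. ennreal \<bar>G s\<bar> * indicator {- x..- y} s \<partial>lborel) =
        (\<integral>\<^sup>+s. ennreal \<bar>G (- s)\<bar> * indicator {- x..- y} (- s) \<partial>lborel)"
      by (rule refl[symmetric]) measurable
    also have "\<dots> = (\<integral>\<^sup>+s. ennreal \<bar>G (- s)\<bar> * indicator {y..x} s \<partial>lborel)"
      by (intro nn_integral_cong) (auto simp: indicator_def)
    finally show "ennreal \<bar>F (- x)\<bar> \<le> ennreal \<bar>F (- y)\<bar> +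
        (\<integral>\<^sup>+s. ennreal \<bar>G (- s)\<bar> * indicator {y..x} s \<partial>lborel)"
      using * dist[of "- x" "- y"] by (intro tri) simp
  qed auto
  also have "(\<integral>\<^sup>+x. ennreal (\<tau> x * \<omega> x * \<bar>F (- x)\<bar>) \<partial>lborel) = ?W"
    using refl[of "\<lambda>x. ennreal (\<tau> x * \<omega> x * \<bar>F x\<bar>)"] by (simp add: even)
  also have "(\<integral>\<^sup>+x. ennreal ((\<omega> x * G (- x))\<^sup>2) \<partial>lborel) = ?E"
    using refl[of "\<lambda>x. ennreal ((\<omega> x * G x)\<^sup>2)"] by (simp add: even)
  also have "(\<integral>\<^sup>+x. ennreal ((\<omega> x * F (- x))\<^sup>2) * indicator {0..} x \<partial>lborel) =
      (\<integral>\<^sup>+x. ennreal ((\<omega> x * F x)\<^sup>2) * indicator {..0} x \<partial>lborel)"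
  proof -
    have "(\<integral>\<^sup>+x. ennreal ((\<omega> x * F x)\<^sup>2) * indicator {..0} x \<partial>lborel) =
      (\<integral>\<^sup>+x. ennreal ((\<omega> (- x) * F (- x))\<^sup>2) * indicator {..0} (- x) \<partial>lborel)"
      by (rule refl[symmetric]) measurable
    also have "\<dots> = (\<integral>\<^sup>+x. ennreal ((\<omega> x * F (- x))\<^sup>2) * indicator {0..} x \<partial>lborel)"
      by (intro nn_integral_cong) (auto simp: indicator_def even)
    finally show ?thesis by simp
  qed
  finally have left: "(\<integral>\<^sup>+x. ennreal ((\<omega> x * F x)\<^sup>2) * indicator {..0} x \<partial>lborel) \<le> ?R" .
  \<comment> \<open>The origin is counted in both half lines, which does no harm in an upper
    bound.\<close>
  have "(\<integral>\<^sup>+x. ennreal ((\<omega> x * F x)\<^sup>2) \<partial>lborel) \<le>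
      (\<integral>\<^sup>+x. ennreal ((\<omega> x * F x)\<^sup>2) * indicator {0..} x
        + ennreal ((\<omega> x * F x)\<^sup>2) * indicator {..0} x \<partial>lborel)"
    by (intro nn_integral_mono) (auto simp: indicator_def)
  also have "\<dots> = (\<integral>\<^sup>+x. ennreal ((\<omega> x * F x)\<^sup>2) * indicator {0..} x \<partial>lborel)
      + (\<integral>\<^sup>+x. ennreal ((\<omega> x * F x)\<^sup>2) * indicator {..0} x \<partial>lborel)"
    by (rule nn_integral_add) measurable
  also have "\<dots> \<le> ?R + ?R" by (rule add_mono[OF right left])
  also have "\<dots> = (ennreal (2 * B\<^sup>2 / \<delta>) + ennreal (2 * B\<^sup>2 / \<delta>)) * ?W\<^sup>2
      + (ennreal (8 * K\<^sup>2 * \<delta>\<^sup>2) + ennreal (8 * K\<^sup>2 * \<delta>\<^sup>2)) * ?E"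
    by (simp add: distrib_right add_ac)
  also have "\<dots> = ennreal (4 * B\<^sup>2 / \<delta>) * ?W\<^sup>2 + ennreal (16 * K\<^sup>2 * \<delta>\<^sup>2) * ?E"
    using \<open>0 < \<delta>\<close> by (simp add: ennreal_plus[symmetric] mult.assoc del: ennreal_plus)
  finally show ?thesis .
qed

section \<open>The weights and the optimisation\<close>

lemma T_ge_1: "1 \<le> T x"
  by (simp add: T_def)

lemma T_uminus [simp]: "T (- x) = T x"
  by (simp add: T_def)

lemma T_mono: "\<bar>x\<bar> \<le> \<bar>y\<bar> \<Longrightarrow> T x \<le> T y"
  by (simp add: T_def abs_le_square_iff)

lemma T_measurable [measurable]: "T \<in> borel_measurable borel"
  unfolding T_def by measurable

text \<open>Since T^2 = 1 + x^2, the product (T x - T y) * (T x + T y) equals (x - y) * (x + y), and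
  T z \<le> 2 * z for z \<ge> 1 bounds the sum T x + T y by 2 * (x + y).\<close>

lemma T_diff_ge:
  assumes "1 \<le> y" "y \<le> x"
  shows "(x - y) / 2 \<le> T x - T y"
proof -
  have le: "T z \<le> 2 * z" if "1 \<le> z" for z
    unfolding T_def using that mult_mono[of 1 z 1 z]
    by (intro real_le_lsqrt) (auto simp: power2_eq_square)
  have sq: "(T z)\<^sup>2 = 1 + z\<^sup>2" for z
    by (simp add: T_def)
  have "(x - y) * (T x + T y) \<le> (x - y) * (2 * (x + y))"
    using assms le[of x] le[of y] by (intro mult_left_mono) auto
  also have "\<dots> = 2 * (T x - T y) * (T x + T y)"
    using sq[of x] sq[of y] by (simp add: algebra_simps power2_eq_square)
  finally have "(x - y) * (T x + T y) \<le> 2 * (T x - T y) * (T x + T y)" .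
  then show ?thesis
    using T_ge_1[of x] T_ge_1[of y] by (subst (asm) mult_le_cancel_right) auto
qed

text \<open>Raise z / q \<le> exp (z / q) to the power q. This trades exponential decay for a
  negative power of z with an explicit constant.\<close>

lemma exp_minus_le_powr:
  fixes q z :: real
  assumes "0 < q" "0 < z"
  shows "exp (- z) \<le> q powr q * z powr (- q)"
proof -
  have "z / q \<le> exp (z / q)"
    using exp_ge_add_one_self[of "z / q"] by linarith
  then have "(z / q) powr q \<le> exp (z / q) powr q"
    using assms by (intro powr_mono2) auto
  then have "z powr q / q powr q \<le> exp z"
    using assms by (simp add: powr_divide exp_powr_real)
  then show ?thesis
    using assms by (simp add: exp_minus powr_minus field_simps)
qed

text \<open>For y \<le> 2 the point y stays in {- 2..2}, where the powers of T are comparable to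
  constants. For y > 2 the difference T x^a - T y^a is at least (T x - T y) * T y^(a - 1). The
  exponent q is fixed by (a - 1) * q = b, so that the resulting decay in T y has exactly the order
  b.\<close>

lemma weight_comparison:
  fixes a b :: real
  assumes "1 < a" "0 < b"
  defines "q \<equiv> b / (a - 1)" and "\<omega> \<equiv> \<lambda>x. exp (- (T x powr a) / 2)"
  obtains B K where "0 < B" "0 < K"
    and "\<And>\<delta> x s. \<delta> \<le> 1 \<Longrightarrow> 0 \<le> x \<Longrightarrow> x - 2 * \<delta> \<le> s \<Longrightarrow> s \<le> x \<Longrightarrow> \<omega> x \<le> K * \<omega> s"
    and "\<And>\<delta> x y. 0 < \<delta> \<Longrightarrow> \<delta> \<le> 1 \<Longrightarrow> 0 \<le> x \<Longrightarrow> x - 2 * \<delta> \<le> y \<Longrightarrow> y \<le> x - \<delta> \<Longrightarrow>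
      \<omega> x \<le> B * \<delta> powr (- q) * (T y powr (- b) * \<omega> y)"
proof -
  \<comment> \<open>For s \<ge> 0 the weight decreases from s to x. For s < 0 the condition \<delta>
    \<le> 1 forces |s| \<le> 2, so \<open>\<omega> s\<close> is at least 1 / K.\<close>
  define K where "K = exp (T 2 powr a / 2)"
  define A where "A = (4 * q) powr q"
  define B where "B = K * T 2 powr b + A"
  have q: "0 < q" using assms by (simp add: q_def)
  have pos: "0 < T x powr r" for x r
    using T_ge_1[of x] by simp
  have K: "\<omega> x \<le> K * \<omega> s" if "\<delta> \<le> 1" "0 \<le> x" "x - 2 * \<delta> \<le> s" "s \<le> x" for \<delta> x s
  proof -
    have "T s powr a \<le> T x powr a \<or> T s powr a \<le> T 2 powr a"
    proof (cases "0 \<le> s")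
      case True
      then have "T s \<le> T x" using that by (intro T_mono) auto
      then show ?thesis using T_ge_1[of s] assms by (intro disjI1 powr_mono2) auto
    next
      case False
      then have "T s \<le> T 2" using that by (intro T_mono) auto
      then show ?thesis using T_ge_1[of s] assms by (intro disjI2 powr_mono2) auto
    qed
    then have "T s powr a \<le> T x powr a + T 2 powr a"
      using pos[of x a] pos[of 2 a] by linarith
    then show ?thesis
      by (simp add: \<omega>_def K_def exp_add[symmetric])
  qed
  have A: "0 < A" using q by (simp add: A_def)
  have "0 < K" by (simp add: K_def)
  have B: "0 < B" unfolding B_def using \<open>0 < K\<close> A pos[of 2 b] by (intro add_pos_pos mult_pos_pos)
  have main: "\<omega> x \<le> B * \<delta> powr (- q) * (T y powr (- b) * \<omega> y)"
    if \<delta>: "0 < \<delta>" "\<delta> \<le> 1" and xy: "0 \<le> x" "x - 2 * \<delta> \<le> y" "y \<le> x - \<delta>" for \<delta> x y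
  proof (cases "y \<le> 2")
    case True
    then have "T y \<le> T 2" using \<delta> xy by (intro T_mono) auto
    then have "T y powr b \<le> T 2 powr b"
      using T_ge_1[of y] assms by (intro powr_mono2) auto
    then have 1: "1 \<le> T 2 powr b * T y powr (- b)"
      using T_ge_1[of y] by (simp add: powr_minus field_simps)
    have 2: "1 \<le> \<delta> powr (- q)"
      using \<delta> q by (simp add: powr_minus one_le_inverse_iff powr_le1)
    have "\<omega> x \<le> K * \<omega> y" using \<delta> xy by (intro K[of \<delta>]) auto
    also have "\<dots> = K * \<omega> y * (1 * 1)" by simp
    also have "\<dots> \<le> K * \<omega> y * ((T 2 powr b * T y powr (- b)) * \<delta> powr (- q))"
      using 1 2 by (intro mult_left_mono mult_mono) (auto simp: K_def \<omega>_def)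
    also have "\<dots> = (K * T 2 powr b) * (\<delta> powr (- q) * (T y powr (- b) * \<omega> y))"
      by (simp add: mult_ac)
    also have "\<dots> \<le> B * (\<delta> powr (- q) * (T y powr (- b) * \<omega> y))"
      using A by (intro mult_right_mono) (auto simp: B_def \<omega>_def)
    finally show ?thesis by (simp add: mult.assoc)
  next
    case False
    \<comment> \<open>Half of the lower bound \<delta> / 2 * T y^(a - 1) for T x^a - T y^a, because
      \<omega> carries the exponent T^a / 2.\<close>
    define z where "z = \<delta> * T y powr (a - 1) / 4"
    have Tpos: "0 < T y" "0 < T x" using T_ge_1[of y] T_ge_1[of x] by auto
    have z: "0 < z" using \<delta> pos[of y "a - 1"] by (simp add: z_def)
    have Txy: "\<delta> / 2 \<le> T x - T y"
      using T_diff_ge[of y x] False xy \<delta> by auto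
    have split: "T u powr a = T u * T u powr (a - 1)" for u
      using T_ge_1[of u] by (simp add: powr_mult_base)
    have "T y powr (a - 1) \<le> T x powr (a - 1)"
      using Txy Tpos \<delta> assms by (intro powr_mono2) auto
    then have "T x * T y powr (a - 1) \<le> T x powr a"
      unfolding split using Tpos by (intro mult_left_mono) auto
    moreover have "\<delta> / 2 * T y powr (a - 1) \<le> (T x - T y) * T y powr (a - 1)"
      using Txy by (intro mult_right_mono) auto
    ultimately have "2 * z \<le> T x powr a - T y powr a"
      unfolding split[of y] by (simp add: z_def algebra_simps)
    then have "\<omega> x \<le> exp (- z) * \<omega> y"
      by (simp add: \<omega>_def exp_add[symmetric])
    also have "\<dots> \<le> (q powr q * z powr (- q)) * \<omega> y"
      using exp_minus_le_powr[OF q z] by (intro mult_right_mono) (auto simp: \<omega>_def)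
    also have "q powr q * z powr (- q) = A * (\<delta> powr (- q) * T y powr (- b))"
    proof -
      have "z powr (- q) = (\<delta> * T y powr (a - 1)) powr (- q) / 4 powr (- q)"
        using \<delta> by (simp add: z_def powr_divide)
      also have "\<dots> = \<delta> powr (- q) * T y powr (- b) * 4 powr q"
      proof -
        have "(a - 1) * q = b" using assms by (simp add: q_def)
        then have "(T y powr (a - 1)) powr (- q) = T y powr (- b)"
          by (simp add: powr_powr)
        then show ?thesis
          using \<delta> by (simp add: powr_mult powr_minus_divide)
      qed
      finally show ?thesis using q by (simp add: A_def powr_mult)
    qed
    also have "A * (\<delta> powr (- q) * T y powr (- b)) * \<omega> y
        = A * (\<delta> powr (- q) * (T y powr (- b) * \<omega> y))"
      by (simp add: mult_ac)
    also have "\<dots> \<le> B * (\<delta> powr (- q) * (T y powr (- b) * \<omega> y))"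
      using \<open>0 < K\<close> pos[of 2 b] by (intro mult_right_mono) (auto simp: B_def \<omega>_def)
    finally show ?thesis by (simp add: mult.assoc)
  qed
  show thesis by (rule that[OF B \<open>0 < K\<close> K main])
qed

section \<open>Optimisation over \<delta>\<close>

text \<open>The two terms balance at \<delta>^(2 + s) = w^2 / e, which is admissible when w^2 < e.
  If e \<le> w^2 the choice \<delta> = 1 suffices, and if w = 0 < e no \<delta> balances, but small
  \<delta> shows L \<le> 0.\<close>

lemma super_Poincare_to_Nash:
  fixes L P s e w :: real
  assumes "0 < P" "0 < s" "0 \<le> e" "0 \<le> w"
    and L: "\<And>\<delta>. 0 < \<delta> \<Longrightarrow> \<delta> \<le> 1 \<Longrightarrow> L \<le> P * (\<delta>\<^sup>2 * e + \<delta> powr (- s) * w\<^sup>2)"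
  shows "L \<le> 2 * P * (w\<^sup>2 + w powr (2 * (1 - s / (2 + s))) * e powr (s / (2 + s)))"
proof -
  let ?R = "w powr (2 * (1 - s / (2 + s))) * e powr (s / (2 + s))"
  have R: "0 \<le> ?R" by simp
  consider "e \<le> w\<^sup>2" | "w = 0" "0 < e" | "0 < w" "w\<^sup>2 < e"
    using assms by fastforce
  then show ?thesis
  proof cases
    case 1
    have double: "e + w\<^sup>2 \<le> 2 * (w\<^sup>2 + r)" if "0 \<le> r" for r :: real
      using 1 that by simp
    have "L \<le> P * (e + w\<^sup>2)" using L[of 1] by simp
    also have "\<dots> \<le> P * (2 * (w\<^sup>2 + ?R))"
      using \<open>0 < P\<close> by (intro mult_left_mono double R) simp
    finally show ?thesis by (simp add: mult_ac)
  next
    case 2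
    have "L \<le> 0"
    proof (rule ccontr)
      assume "\<not> L \<le> 0"
      \<comment> \<open>Small enough for P * e * \<delta> to be at most L / 2; as \<delta>^2 \<le>
        \<delta>, this contradicts the assumed bound when L > 0.\<close>
      define \<delta> where "\<delta> = min 1 (L / (2 * P * e))"
      have \<delta>: "0 < \<delta>" "\<delta> \<le> 1" "\<delta> \<le> L / (2 * P * e)"
        using \<open>\<not> L \<le> 0\<close> 2 \<open>0 < P\<close> by (auto simp: \<delta>_def)
      have "L \<le> (P * e) * \<delta>\<^sup>2" using L[OF \<delta>(1,2)] 2 by (simp add: mult_ac)
      also have "\<dots> \<le> (P * e) * \<delta>"
        using \<delta> 2 \<open>0 < P\<close> by (intro mult_left_mono) (auto simp: power2_eq_square mult_left_le)
      also have "\<dots> \<le> (P * e) * (L / (2 * P * e))"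
        using \<delta> 2 \<open>0 < P\<close> by (intro mult_left_mono) auto
      also have "\<dots> = L / 2" using 2 \<open>0 < P\<close> by simp
      finally show False using \<open>\<not> L \<le> 0\<close> by simp
    qed
    then show ?thesis using 2 by simp
  next
    case 3
    \<comment> \<open>The balancing value, written with logarithms so that the powers become linear
      identities in ln w and ln e. Both terms turn out equal to the claimed product.\<close>
    define \<delta> where "\<delta> = exp ((2 * ln w - ln e) / (2 + s))"
    have e: "0 < e" using 3 by (smt (verit) zero_le_power2)
    have ln: "2 * ln w < ln e"
      using 3 e ln_less_cancel_iff[of "w\<^sup>2" e] by (simp add: ln_realpow)
    have \<delta>: "0 < \<delta>" "\<delta> \<le> 1"
      using ln \<open>0 < s\<close> by (auto simp: \<delta>_def divide_nonpos_pos)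
    have Re: "?R = exp ((4 * ln w + s * ln e) / (2 + s))"
    proof -
      have "2 * (1 - s / (2 + s)) = 4 / (2 + s)"
        using \<open>0 < s\<close> by (simp add: field_simps)
      then have "2 * (1 - s / (2 + s)) * ln w + s / (2 + s) * ln e = (4 * ln w + s * ln e) / (2 + s)"
        by (simp add: add_divide_distrib)
      then show ?thesis
        using 3 e by (simp add: powr_def exp_add[symmetric])
    qed
    have "\<delta>\<^sup>2 * e = exp (2 * ((2 * ln w - ln e) / (2 + s)) + ln e)"
      by (simp only: \<delta>_def exp_add exp_double exp_ln[OF e])
    also have "2 * ((2 * ln w - ln e) / (2 + s)) + ln e = (4 * ln w + s * ln e) / (2 + s)"
      using \<open>0 < s\<close> by (simp add: field_simps)
    finally have 1: "\<delta>\<^sup>2 * e = ?R" using Re by simp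
    have "\<delta> powr (- s) * w\<^sup>2 = exp (- s * ((2 * ln w - ln e) / (2 + s)) + 2 * ln w)"
    proof -
      have "\<delta> powr (- s) = exp (- s * ((2 * ln w - ln e) / (2 + s)))"
        by (simp add: \<delta>_def powr_def)
      then show ?thesis
        using 3 by (simp only: exp_add exp_double exp_ln)
    qed
    also have "- s * ((2 * ln w - ln e) / (2 + s)) + 2 * ln w = (4 * ln w + s * ln e) / (2 + s)"
      using \<open>0 < s\<close> by (simp add: field_simps)
    finally have 2: "\<delta> powr (- s) * w\<^sup>2 = ?R" using Re by simp
    have "L \<le> P * (?R + ?R)" using L[OF \<delta>] 1 2 by simp
    also have "\<dots> = 2 * P * ?R" by simp
    also have "\<dots> \<le> 2 * P * (w\<^sup>2 + ?R)"
      using \<open>0 < P\<close> by (intro mult_left_mono) auto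
    finally show ?thesis .
  qed
qed

section \<open>The family of inequalities for \<open>mu a\<close>\<close>

text \<open>The density of \<open>mu a\<close> is c * \<omega>^2, so norm and form are c times the
  integrals of the estimate on the line. The quantifiers matter: P and s depend on a and \<beta>
  only.\<close>

lemma mu_super_Poincare:
  fixes a \<beta> :: real
  assumes "1 < a"
  obtains P s where "0 < P" "0 < s"
    and "\<And>f \<delta>. f \<in> dirichlet_domain a \<Longrightarrow> weighted_integral a \<beta> f \<noteq> \<infinity> \<Longrightarrow> 0 < \<delta> \<Longrightarrow> \<delta> \<le> 1 \<Longrightarrow>
      (L2_norm (mu a) f)\<^sup>2 \<le>
        P * (\<delta>\<^sup>2 * dirichlet_form a f f + \<delta> powr (- s) * (enn2real (weighted_integral a \<beta> f))\<^sup>2)"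
proof -
  \<comment> \<open>Positive, as the weight comparison requires, and at least \<beta>, so that
    \<tau> \<le> T^(- \<beta>) whatever the sign of \<beta>.\<close>
  define b where "b = \<bar>\<beta>\<bar> + 1"
  define q where "q = b / (a - 1)"
  define \<omega> where "\<omega> = (\<lambda>x. exp (- (T x powr a) / 2))"
  define \<tau> where "\<tau> = (\<lambda>x. T x powr (- b))"
  define c where "c = norm_const a"
  have "0 < b" by (simp add: b_def)
  obtain B K where BK: "0 < B" "0 < K"
    and K: "\<And>\<delta> x s. \<delta> \<le> 1 \<Longrightarrow> 0 \<le> x \<Longrightarrow> x - 2 * \<delta> \<le> s \<Longrightarrow> s \<le> x \<Longrightarrow> \<omega> x \<le> K * \<omega> s"
    and B: "\<And>\<delta> x y. 0 < \<delta> \<Longrightarrow> \<delta> \<le> 1 \<Longrightarrow> 0 \<le> x \<Longrightarrow> x - 2 * \<delta> \<le> y \<Longrightarrow> y \<le> x - \<delta> \<Longrightarrow>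
      \<omega> x \<le> B * \<delta> powr (- q) * (\<tau> y * \<omega> y)"
    by (rule weight_comparison[OF assms \<open>0 < b\<close>]) (rule that, unfold \<omega>_def \<tau>_def q_def)
  have [measurable]: "\<omega> \<in> borel_measurable borel" "\<tau> \<in> borel_measurable borel"
    unfolding \<omega>_def \<tau>_def by measurable
  have pos: "0 < \<omega> x" "0 < \<tau> x" for x
    using T_ge_1[of x] by (auto simp: \<omega>_def \<tau>_def)
  have "0 \<le> c"
    by (simp add: c_def norm_const_def Bochner_Integration.integral_nonneg)
  have \<omega>2: "exp (- (T x powr a)) = (\<omega> x)\<^sup>2" for x
    by (simp add: \<omega>_def power2_eq_square exp_add[symmetric])
  have mu: "mu a = density lborel (\<lambda>x. ennreal (c * (\<omega> x)\<^sup>2))"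
    by (simp add: mu_def c_def \<omega>2)
  have sets_mu: "borel_measurable (mu a) = borel_measurable borel"
    by (simp add: mu measurable_def)
  have L2_eq: "ennreal (\<integral>x. (h x)\<^sup>2 \<partial>mu a) = ennreal c * (\<integral>\<^sup>+x. ennreal ((\<omega> x * h x)\<^sup>2) \<partial>lborel)"
    if "h \<in> L2 (mu a)" for h
  proof -
    have [measurable]: "h \<in> borel_measurable borel"
      using that by (simp add: L2_def sets_mu)
    have "ennreal (\<integral>x. (h x)\<^sup>2 \<partial>mu a) = (\<integral>\<^sup>+x. ennreal ((h x)\<^sup>2) \<partial>mu a)"
      using that by (intro nn_integral_eq_integral[symmetric]) (auto simp: L2_def)
    also have "\<dots> = (\<integral>\<^sup>+x. ennreal (c * (\<omega> x)\<^sup>2) * ennreal ((h x)\<^sup>2) \<partial>lborel)"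
      unfolding mu by (rule nn_integral_density) measurable
    also have "\<dots> = (\<integral>\<^sup>+x. ennreal c * ennreal ((\<omega> x * h x)\<^sup>2) \<partial>lborel)"
      using \<open>0 \<le> c\<close> by (intro nn_integral_cong)
        (simp add: ennreal_mult[symmetric] power_mult_distrib mult.assoc)
    also have "\<dots> = ennreal c * (\<integral>\<^sup>+x. ennreal ((\<omega> x * h x)\<^sup>2) \<partial>lborel)"
      by (rule nn_integral_cmult) measurable
    finally show ?thesis .
  qed
  \<comment> \<open>If the density were not integrable, \<open>norm_const a\<close> would be \<open>1 / 0 = 0\<close>; \<open>M\<close> covers this case,
    in which both sides vanish.\<close>
  define M where "M = (if c = 0 then 1 else 1 / c)"
  have "0 < M" using \<open>0 \<le> c\<close> by (simp add: M_def)
  define P where "P = max (4 * B\<^sup>2 * M) (16 * K\<^sup>2)"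
  have "0 < P" unfolding P_def using \<open>0 < M\<close> BK by (simp add: max_def)
  have "0 < q" using assms \<open>0 < b\<close> by (simp add: q_def)
  show thesis
  proof (rule that[OF \<open>0 < P\<close>])
    show "0 < 2 * q + 1" using \<open>0 < q\<close> by simp
    fix f \<delta>
    assume f: "f \<in> dirichlet_domain a" and W: "weighted_integral a \<beta> f \<noteq> \<infinity>"
      and \<delta>: "0 < \<delta>" "\<delta> \<le> (1::real)"
    define g where "g = weak_deriv a f"
    \<comment> \<open>Membership in the domain guarantees that the choice in
      \<open>weak_deriv\<close> returns a genuine weak derivative in L2.\<close>
    have "\<exists>g. g \<in> L2 (mu a) \<and> has_weak_derivative f g"
      using f unfolding dirichlet_domain_def by blast
    then have "g \<in> L2 (mu a) \<and> has_weak_derivative f g"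
      unfolding g_def weak_deriv_def by (rule someI_ex)
    then have g: "g \<in> L2 (mu a)" "has_weak_derivative f g" by auto
    have fL: "f \<in> L2 (mu a)" using f unfolding dirichlet_domain_def by blast
    have [measurable]: "f \<in> borel_measurable borel" "g \<in> borel_measurable borel"
      using fL g by (auto simp: L2_def sets_mu)
    define U where "U = (\<integral>\<^sup>+x. ennreal ((\<omega> x * f x)\<^sup>2) \<partial>lborel)"
    define E where "E = (\<integral>\<^sup>+x. ennreal ((\<omega> x * g x)\<^sup>2) \<partial>lborel)"
    define w0 where "w0 = (\<integral>\<^sup>+x. ennreal (\<tau> x * \<omega> x * \<bar>f x\<bar>) \<partial>lborel)"
    define w where "w = enn2real (weighted_integral a \<beta> f)"
    define e where "e = dirichlet_form a f f"
    have w: "weighted_integral a \<beta> f = ennreal w" "0 \<le> w"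
      using W by (auto simp: w_def less_top)
    have Uc: "ennreal ((L2_norm (mu a) f)\<^sup>2) = ennreal c * U"
      using L2_eq[OF fL] by (simp add: L2_norm_def U_def)
    have ec: "ennreal e = ennreal c * E" and "0 \<le> e"
      using L2_eq[OF g(1)] by (auto simp: e_def dirichlet_form_def g_def[symmetric] E_def power2_eq_square)
    have wc: "ennreal c * w0 \<le> ennreal w"
    proof -
      have "ennreal c * w0 = (\<integral>\<^sup>+x. ennreal c * ennreal (\<tau> x * \<omega> x * \<bar>f x\<bar>) \<partial>lborel)"
        unfolding w0_def by (rule nn_integral_cmult[symmetric]) measurable
      also have "\<dots> \<le> (\<integral>\<^sup>+x. ennreal (c * (\<omega> x)\<^sup>2) * ennreal (\<bar>f x\<bar> * V a \<beta> x) \<partial>lborel)"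
      proof (rule nn_integral_mono)
        fix x
        \<comment> \<open>The exponential in V cancels one of the two factors \<omega> of the
          density, leaving c * T^(- \<beta>) * \<omega>, which dominates c * \<tau> *
          \<omega>.\<close>
        have "exp (T x powr a / 2) * \<omega> x = 1"
          by (simp add: \<omega>_def exp_add[symmetric])
        then have "V a \<beta> x * (\<omega> x)\<^sup>2 = T x powr (- \<beta>) * \<omega> x"
          by (simp add: V_def power2_eq_square mult_ac)
        moreover have "\<tau> x \<le> T x powr (- \<beta>)"
          unfolding \<tau>_def using T_ge_1[of x] by (intro powr_mono) (auto simp: b_def)
        ultimately have "\<tau> x * \<omega> x \<le> V a \<beta> x * (\<omega> x)\<^sup>2"
          using pos(1)[of x] by (simp add: mult_right_mono)
        then have "c * (\<tau> x * \<omega> x) * \<bar>f x\<bar> \<le> c * (V a \<beta> x * (\<omega> x)\<^sup>2) * \<bar>f x\<bar>"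
          using \<open>0 \<le> c\<close> by (intro mult_right_mono mult_left_mono) auto
        moreover have "0 \<le> V a \<beta> x" by (simp add: V_def)
        ultimately show "ennreal c * ennreal (\<tau> x * \<omega> x * \<bar>f x\<bar>) \<le>
            ennreal (c * (\<omega> x)\<^sup>2) * ennreal (\<bar>f x\<bar> * V a \<beta> x)"
          using \<open>0 \<le> c\<close> by (simp add: ennreal_mult'[symmetric] ennreal_leI mult_ac)
      qed
      also have "\<dots> = (\<integral>\<^sup>+x. ennreal (\<bar>f x\<bar> * V a \<beta> x) \<partial>mu a)"
        unfolding mu V_def by (rule nn_integral_density[symmetric]) measurable
      finally show ?thesis unfolding w(1)[symmetric] weighted_integral_def .
    qed
    \<comment> \<open>The left side is linear in c while the square of the weighted integral is
      quadratic; the factor M = 1 / c makes up for it when c is nonzero.\<close>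
    have wc2: "ennreal c * w0\<^sup>2 \<le> ennreal (M * w\<^sup>2)"
    proof (cases "c = 0")
      case False
      then have "ennreal c * ennreal M = 1"
        using \<open>0 \<le> c\<close> by (simp add: M_def ennreal_mult[symmetric])
      then have "ennreal c * w0\<^sup>2 = ennreal M * (ennreal c * w0)\<^sup>2"
        by (simp add: power2_eq_square mult_ac) (metis mult.assoc mult.commute mult.right_neutral)
      also have "\<dots> \<le> ennreal M * (ennreal w)\<^sup>2"
        by (intro mult_left_mono power_mono wc) auto
      also have "\<dots> = ennreal (M * w\<^sup>2)"
        using w(2) \<open>0 < M\<close> by (simp add: ennreal_mult ennreal_power)
      finally show ?thesis .
    qed simp
    have "U \<le> ennreal (4 * (B * \<delta> powr (- q))\<^sup>2 / \<delta>) * w0\<^sup>2 + ennreal (16 * K\<^sup>2 * \<delta>\<^sup>2) * E"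
      unfolding U_def w0_def E_def
    proof (rule line_estimate[OF _ _ _ _ less_imp_le[OF pos(1)] less_imp_le[OF pos(2)] \<delta>(1) _ _ _ _ g(2)])
      show "\<omega> x \<le> B * \<delta> powr (- q) * (\<tau> y * \<omega> y)"
        if "0 \<le> x" "x - 2 * \<delta> \<le> y" "y \<le> x - \<delta>" for x y
        by (rule B[OF \<delta> that])
      show "\<omega> x \<le> K * \<omega> s" if "0 \<le> x" "x - 2 * \<delta> \<le> s" "s \<le> x" for x s
        by (rule K[OF \<delta>(2) that])
    qed (use BK in \<open>auto simp: \<omega>_def \<tau>_def\<close>)
    \<comment> \<open>The exponent s = 2 * q + 1 arises here: 2 * q from squaring the weight
      comparison, 1 from averaging over a window of length \<delta>.\<close>
    also have "4 * (B * \<delta> powr (- q))\<^sup>2 / \<delta> = 4 * B\<^sup>2 * \<delta> powr (- (2 * q + 1))"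
    proof -
      have "\<delta> powr (- (2 * q + 1)) = \<delta> powr (- q) * \<delta> powr (- q) * \<delta> powr (- 1)"
      proof -
        have "- (2 * q + 1) = (- q) + (- q) + (- 1)" by simp
        then show ?thesis by (simp only: powr_add)
      qed
      also have "\<delta> powr (- 1) = 1 / \<delta>"
        using \<delta> by (simp add: powr_minus divide_inverse)
      finally show ?thesis by (simp add: power2_eq_square)
    qed
    finally have "ennreal c * U \<le> ennreal c *
        (ennreal (4 * B\<^sup>2 * \<delta> powr (- (2 * q + 1))) * w0\<^sup>2 + ennreal (16 * K\<^sup>2 * \<delta>\<^sup>2) * E)"
      by (rule mult_left_mono) simp
    also have "\<dots> = ennreal (4 * B\<^sup>2 * \<delta> powr (- (2 * q + 1))) * (ennreal c * w0\<^sup>2)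
        + ennreal (16 * K\<^sup>2 * \<delta>\<^sup>2) * ennreal e"
      unfolding ec by (simp add: distrib_left mult_ac)
    also have "\<dots> \<le> ennreal (4 * B\<^sup>2 * \<delta> powr (- (2 * q + 1))) * ennreal (M * w\<^sup>2)
        + ennreal (16 * K\<^sup>2 * \<delta>\<^sup>2) * ennreal e"
      by (intro add_mono mult_left_mono wc2) auto
    also have "\<dots> = ennreal ((4 * B\<^sup>2 * M) * (\<delta> powr (- (2 * q + 1)) * w\<^sup>2) + (16 * K\<^sup>2) * (\<delta>\<^sup>2 * e))"
      using \<open>0 < M\<close> \<open>0 \<le> e\<close> by (simp add: ennreal_mult[symmetric] mult_ac)
    finally have "(L2_norm (mu a) f)\<^sup>2 \<le>
        (4 * B\<^sup>2 * M) * (\<delta> powr (- (2 * q + 1)) * w\<^sup>2) + (16 * K\<^sup>2) * (\<delta>\<^sup>2 * e)"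
      unfolding Uc[symmetric] using \<open>0 < M\<close> \<open>0 \<le> e\<close> by (subst (asm) ennreal_le_iff) auto
    also have "\<dots> \<le> P * (\<delta> powr (- (2 * q + 1)) * w\<^sup>2) + P * (\<delta>\<^sup>2 * e)"
      using \<open>0 \<le> e\<close> by (intro add_mono mult_right_mono) (auto simp: P_def)
    finally show "(L2_norm (mu a) f)\<^sup>2 \<le> P * (\<delta>\<^sup>2 * dirichlet_form a f f
        + \<delta> powr (- (2 * q + 1)) * (enn2real (weighted_integral a \<beta> f))\<^sup>2)"
      by (simp add: e_def w_def algebra_simps)
  qed
qed

theorem theorem4p10:
  fixes a \<beta> :: real
  assumes "a > 1"
  shows "\<exists>C>0. \<exists>\<theta>\<in>{0<..<1::real}. \<forall>f \<in> dirichlet_domain a.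
    ennreal ((L2_norm (mu a) f)\<^sup>2) \<le>
      (if weighted_integral a \<beta> f = \<infinity> then \<infinity>
       else ennreal (C * ((enn2real (weighted_integral a \<beta> f))\<^sup>2 +
              enn2real (weighted_integral a \<beta> f) powr (2 * (1 - \<theta>)) *
                dirichlet_form a f f powr \<theta>)))"
proof -
  obtain P s where P: "0 < P" "0 < s" and super: "\<And>f \<delta>. f \<in> dirichlet_domain a \<Longrightarrow>
      weighted_integral a \<beta> f \<noteq> \<infinity> \<Longrightarrow> 0 < \<delta> \<Longrightarrow> \<delta> \<le> 1 \<Longrightarrow>
      (L2_norm (mu a) f)\<^sup>2 \<le>
        P * (\<delta>\<^sup>2 * dirichlet_form a f f + \<delta> powr (- s) * (enn2real (weighted_integral a \<beta> f))\<^sup>2)"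
    by (rule mu_super_Poincare[OF assms, of \<beta>]) (rule that)
  have form_nonneg: "0 \<le> dirichlet_form a f f" for f
    by (simp add: dirichlet_form_def)
  show ?thesis
  \<comment> \<open>Both witnesses are independent of f; s > 0 places the exponent strictly between
    0 and 1.\<close>
  proof (intro exI[of _ "2 * P"] conjI bexI[of _ "s / (2 + s)"] ballI)
    fix f assume f: "f \<in> dirichlet_domain a"
    have bound: "(L2_norm (mu a) f)\<^sup>2 \<le> 2 * P * ((enn2real (weighted_integral a \<beta> f))\<^sup>2 +
        enn2real (weighted_integral a \<beta> f) powr (2 * (1 - s / (2 + s))) *
          dirichlet_form a f f powr (s / (2 + s)))" if "weighted_integral a \<beta> f \<noteq> \<infinity>"
      by (rule super_Poincare_to_Nash[OF P form_nonneg enn2real_nonneg super[OF f that]])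
    show "ennreal ((L2_norm (mu a) f)\<^sup>2) \<le>
      (if weighted_integral a \<beta> f = \<infinity> then \<infinity>
       else ennreal (2 * P * ((enn2real (weighted_integral a \<beta> f))\<^sup>2 +
              enn2real (weighted_integral a \<beta> f) powr (2 * (1 - s / (2 + s))) *
                dirichlet_form a f f powr (s / (2 + s)))))"
      by (cases "weighted_integral a \<beta> f = \<infinity>") (simp, simp only: if_False, intro ennreal_leI bound)
  qed (use P in auto)
qed

end
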